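(* Let $C\subset\mathbb{R}^2$ be a circle centered at the origin $(0,0)$, let $\mathbf{x}_0$ be a point of $C$ lying on the $x$-axis, and let $U$ be an open neighborhood of $C$ with $C\subset U\subset \mathbb{R}^2\setminus\{(0,0)\}$. Let $a>0$ and let $g:U\times(-a,a)\to\mathbb{R}^2$ be continuous and such that (i) $g(\mathbf{r},0)=-\dfrac{\kappa}{\|\mathbf{r}\|^{3}}\,\mathbf{r}$ for all $\mathbf{r}\in U$, where $\kappa>0$ is a constant; (ii) for each $\mu\in(-a,a)$, the map $\mathbf{r}\mapsto g(\mathbf{r},\mu)$ is $C^1$ on $U$; (iii) for all $\mu\in(-a,a)$, $g(\cdot,\mu)$ is invariant (as a vector field) under the reflections $\varphi_1(x,y)=(-x,y)$ and $\varphi_2(x,y)=(x,-y)$; that is, $\varphi_i(U)=U$ and $g(\varphi_i(\mathbf{r}),\mu)=\varphi_i(g(\mathbf{r},\mu))$ for all $\mathbf{r}\in U$, $i=1,2$. Then one can choose $\delta_0$ with $0<\delta_0<a$ such that for each $\mu\in(-\delta_0,\delta_0)$ there is $\mathbf{v}_\mu\in\mathbb{R}^2$ for which $\mathbf{r}(t,\mathbf{x}_0,\mathbf{v}_\mu,\mu)$ is periodic, and such that, moreover, there is a compact connected set $\mathcal{V}\subset\mathbb{R}^2\times(-a,a)\subset\mathbb{R}^2\times\mathbb{R}$ with the following properties: 1) $\mathcal{V}_\mu:=\mathcal{V}\cap(\mathbb{R}^2\times\{\mu\})\neq\emptyset$ for all $\mu\in[0,\delta_0]$; 2) for every $(\mathbf{v},\mu)\in\mathcal{V}$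 the solution $\mathbf{r}(t,\mathbf{x}_0,\mathbf{v},\mu)$ of $\ddot{\mathbf{r}}=g(\mathbf{r},\mu)$ is periodic, and its trace is a simple closed curve which is symmetric with respect to the $x$-axis and the $y$-axis and encloses the origin.
   Context: $\mathbf{r}(t,\mathbf{x},\mathbf{v},\mu)$ denotes the solution of the second order ODE $\ddot{\mathbf{r}}=g(\mathbf{r},\mu)$ with initial conditions $\mathbf{r}(0,\mathbf{x},\mathbf{v},\mu)=\mathbf{x}$ and $\dot{\mathbf{r}}(0,\mathbf{x},\mathbf{v},\mu)=\mathbf{v}$. The trace of a solution is its image in $\mathbb{R}^2$. A simple closed curve $S\subset\mathbb{R}^2$ encloses a point $p\notin S$ if $p$ belongs to the bounded component of $\mathbb{R}^2\setminus S$. *)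

theory Defs
  imports "HOL-Analysis.Analysis"
begin

type_synonym plane = "real \<times> real"

definition reflect1 :: "plane \<Rightarrow> plane" where
  "reflect1 = (\<lambda>(x, y). (- x, y))"

definition reflect2 :: "plane \<Rightarrow> plane" where
  "reflect2 = (\<lambda>(x, y). (x, - y))"

definition C1_on :: "plane set \<Rightarrow> (plane \<Rightarrow> plane) \<Rightarrow> bool" where
  "C1_on U f \<longleftrightarrow>
     (\<exists>f' :: plane \<Rightarrow> plane \<Rightarrow>\<^sub>L plane.
        (\<forall>p\<in>U. (f has_derivative blinfun_apply (f' p)) (at p)) \<and> continuous_on U f')"

definition solves_ivp ::
  "plane set \<Rightarrow> (plane \<Rightarrow> real \<Rightarrow> plane) \<Rightarrow> plane \<Rightarrow> plane \<Rightarrow> real \<Rightarrow> real set \<Rightarrow> (real \<Rightarrow> plane) \<Rightarrow> bool"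
where
  "solves_ivp U g x v \<mu> J r \<longleftrightarrow>
     open J \<and> is_interval J \<and> 0 \<in> J \<and>
     (\<exists>r'. r 0 = x \<and> r' 0 = v \<and>
        (\<forall>t\<in>J. r t \<in> U \<and> (r has_vector_derivative r' t) (at t) \<and>
                (r' has_vector_derivative g (r t) \<mu>) (at t)))"

text \<open>The maximal solution of the initial value problem: its interval of existence is the union
  of the domains of all local solutions, and its value at \<open>t\<close> is their common value.
  The description is meaningful whenever solutions are unique, in particular for vector fields
  that are continuously differentiable in the position.\<close>

definition sol_domain ::
  "plane set \<Rightarrow> (plane \<Rightarrow> real \<Rightarrow> plane) \<Rightarrow> plane \<Rightarrow> plane \<Rightarrow> real \<Rightarrow> real set"
where
  "sol_domain U g x v \<mu> = \<Union> {J. \<exists>r. solves_ivp U g x v \<mu> J r}"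

definition sol ::
  "plane set \<Rightarrow> (plane \<Rightarrow> real \<Rightarrow> plane) \<Rightarrow> plane \<Rightarrow> plane \<Rightarrow> real \<Rightarrow> real \<Rightarrow> plane"
where
  "sol U g x v \<mu> t = (THE y. \<exists>J r. solves_ivp U g x v \<mu> J r \<and> t \<in> J \<and> y = r t)"

definition periodic_sol ::
  "plane set \<Rightarrow> (plane \<Rightarrow> real \<Rightarrow> plane) \<Rightarrow> plane \<Rightarrow> plane \<Rightarrow> real \<Rightarrow> bool"
where
  "periodic_sol U g x v \<mu> \<longleftrightarrow>
     sol_domain U g x v \<mu> = UNIV \<and>
     (\<exists>T>0. \<forall>t. sol U g x v \<mu> (t + T) = sol U g x v \<mu> t)"

definition sol_trace ::
  "plane set \<Rightarrow> (plane \<Rightarrow> real \<Rightarrow> plane) \<Rightarrow> plane \<Rightarrow> plane \<Rightarrow> real \<Rightarrow> plane set"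
where
  "sol_trace U g x v \<mu> = sol U g x v \<mu> ` sol_domain U g x v \<mu>"

definition simple_closed_curve :: "plane set \<Rightarrow> bool" where
  "simple_closed_curve S \<longleftrightarrow>
     (\<exists>c. simple_path c \<and> pathfinish c = pathstart c \<and> path_image c = S)"

end

theory Submission
  imports Defs
begin

text \<open>Why the theorem holds. By the symmetry under the point reflection it suffices to start at
\<open>(\<rho>, 0)\<close>, and only velocities \<open>(0, s)\<close> perpendicular to the \<open>x\<close>-axis are used. The reflection in
the \<open>x\<close>-axis combined with time reversal maps the solution to itself. If the solution meets the
\<open>y\<close>-axis at a time \<open>T\<close>, again perpendicularly, then the reflection in the \<open>y\<close>-axis combined with
the time reversal \<open>t \<mapsto> 2 T - t\<close> also maps the solution to itself, and the two symmetries together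
make it periodic with period \<open>4 T\<close>. As long as the angular momentum stays positive, the polar angle
increases strictly, from \<open>0\<close> to \<open>2 \<pi>\<close> over one period, so the trace meets every ray from the
origin exactly once: it is a simple closed curve around the origin
(\<open>quarter_orbit_symmetric\<close>, based on \<open>polar_angle\<close> and \<open>polar_closed_curve\<close>).

It remains to solve, for every small \<open>\<mu>\<close>, two equations in the two unknowns \<open>T\<close> and \<open>s\<close>:
the abscissa and the vertical velocity at time \<open>T\<close> both vanish. The derivative of the force
need not depend continuously on \<open>\<mu>\<close>, so the implicit function theorem does not apply; the
argument rests on changes of sign instead. On a box around the time of the quarter turn and the speed of the circular orbit,
the abscissa is positive at the earliest and negative at the latest time. The vertical velocity
has no evident sign on the two faces where \<open>s\<close> is extremal, so it is
replaced by the first component of the Laplace-Runge-Lenz vector (times the radius). When the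
abscissa vanishes and the angular momentum does not, the two have the same zeros; but for
\<open>\<mu> = 0\<close> the new quantity is conserved, equal to \<open>\<rho> s\<^sup>2 - \<kappa>\<close> up to the factor given by the radius
(\<open>runge_conserved\<close>), hence of constant sign on each of these faces. By
compactness all signs persist for small \<open>\<mu>\<close>. The theorem of Poincare and Miranda then gives
zeros for every \<open>\<mu>\<close>, and a separation argument for compact sets turns them into a
continuum of zeros lying over a whole parameter interval (\<open>continuum_of_zeros\<close>); dropping the
coordinate \<open>T\<close> gives the set \<open>V\<close> of the theorem.

The analytic input is existence, uniqueness and continuous dependence of solutions. The force
is multiplied by a cut-off function supported in an annulus around the circle. For each \<open>\<mu>\<close> the
product is globally Lipschitz, so that a global flow exists, and orbits that stay near the circle
are orbits of the original equation. The Lipschitz constant is not uniform in \<open>\<mu>\<close>; continuity of the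
flow at a parameter uses only the constant at that parameter (\<open>flow_close\<close>).\<close>

section \<open>Ordinary differential equations with a Lipschitz right-hand side\<close>

lemma antiderivative_on_line:
  fixes f :: "real \<Rightarrow> 'a::euclidean_space"
  assumes "continuous_on UNIV f"
  obtains F where "F 0 = 0" "\<And>t. (F has_vector_derivative f t) (at t)"
proof (rule that [of "\<lambda>t::real. LBINT y=0..t. f y"])
  let ?F = "\<lambda>t::real. LBINT y=0..t. f y"
  show "?F 0 = 0" by (simp add: zero_ereal_def [symmetric])
  show "(?F has_vector_derivative f t) (at t)" for t
  proof -
    let ?a = "- \<bar>t\<bar> - 1" and ?b = "\<bar>t\<bar> + 1"
    have "(?F has_vector_derivative f t) (at t within {?a..?b})"
      by (rule interval_integral_FTC2 [where c = 0, simplified zero_ereal_def [symmetric]])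
         (auto intro: continuous_on_subset [OF assms])
    moreover have "t \<in> interior {?a..?b}" by auto
    ultimately show ?thesis by (simp only: at_within_interior)
  qed
qed

text \<open>Bounds the weighted norm \<open>exp (- c \<bar>t\<bar>) \<parallel>F t\<parallel>\<close> of an antiderivative; the factor
\<open>1 / c\<close> is what makes the Picard operator a contraction.\<close>

lemma exponential_growth_bound:
  fixes F f :: "real \<Rightarrow> 'a::real_normed_vector"
  assumes F: "\<And>t. (F has_vector_derivative f t) (at t)" "F 0 = 0"
    and c: "c > 0" and bound: "\<And>t. norm (f t) \<le> B * exp (c * \<bar>t\<bar>)"
  shows "norm (F t) \<le> B / c * exp (c * \<bar>t\<bar>)"
proof -
  have B: "0 \<le> B" using order_trans [OF norm_ge_zero bound [of 0]] by simp
  have forward: "norm (G \<tau>) \<le> B / c * exp (c * \<tau>)"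
    if G: "\<And>t. (G has_vector_derivative g t) (at t)" "G 0 = 0"
      and g: "\<And>t. norm (g t) \<le> B * exp (c * \<bar>t\<bar>)" and "\<tau> \<ge> 0"
    for G g :: "real \<Rightarrow> 'a" and \<tau> :: real
  proof (cases "\<tau> = 0")
    case True then show ?thesis using G B c by simp
  next
    case False
    have "norm (G \<tau> - G 0) \<le> B / c * exp (c * \<tau>) - B / c * exp (c * 0)"
    proof (rule differentiable_bound_general [where f' = g and \<phi>' = "\<lambda>t. B * exp (c * t)"])
      show "0 < \<tau>" using False \<open>\<tau> \<ge> 0\<close> by simp
      show "continuous_on {0..\<tau>} G"
        using G(1) by (meson continuous_at_imp_continuous_on has_vector_derivative_continuous)
      show "continuous_on {0..\<tau>} (\<lambda>t. B / c * exp (c * t))" by (intro continuous_intros)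
      show "(G has_vector_derivative g x) (at x)" for x by fact
      show "((\<lambda>t. B / c * exp (c * t)) has_vector_derivative B * exp (c * x)) (at x)" for x
        unfolding has_real_derivative_iff_has_vector_derivative [symmetric]
        by (rule derivative_eq_intros refl | use c in simp)+
      show "norm (g x) \<le> B * exp (c * x)" if "0 < x" for x using g [of x] that by simp
    qed
    then show ?thesis using G(2) B c by (simp add: field_simps)
  qed
  show ?thesis
  proof (cases "t \<ge> 0")
    case True then show ?thesis using forward [OF F bound True] by simp
  next
    case False
    have "((\<lambda>t. F (- t)) has_vector_derivative - f (- t)) (at t)" for t
      using vector_diff_chain_at [OF _ F(1), of uminus "-1" t]
      by (simp add: o_def has_real_derivative_iff_has_vector_derivative [symmetric] DERIV_minus)
    moreover have "norm (- f (- s)) \<le> B * exp (c * \<bar>s\<bar>)" for s using bound [of "- s"] by simp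
    ultimately have "norm (F (- (- t))) \<le> B / c * exp (c * (- t))"
      using False F(2) by (intro forward [where G = "\<lambda>t. F (- t)"]) auto
    then show ?thesis using False by simp
  qed
qed

text \<open>The Picard operator is a contraction on the whole line at once for the norm weighted by
\<open>exp (- c \<bar>t\<bar>)\<close> with \<open>c > L\<close>. The unknown is the bounded function \<open>u\<close>
with solution \<open>y0 + exp (c \<bar>t\<bar>) u t\<close>, so the fixed point is taken among bounded continuous functions.\<close>

lemma global_solution_exists:
  fixes F :: "'a::euclidean_space \<Rightarrow> 'a"
  assumes L: "L-lipschitz_on UNIV F"
  obtains Y where "Y 0 = y0" "\<And>t. (Y has_vector_derivative F (Y t)) (at t)"
proof -
  have "0 \<le> L" using L by (rule lipschitz_on_nonneg)
  define c where "c = 2 * L + 1"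
  have c: "c > 0" using \<open>0 \<le> L\<close> by (simp add: c_def)
  have Fcont: "continuous_on UNIV F" using L by (rule lipschitz_on_continuous_on)
  have Flip: "norm (F x - F y) \<le> L * norm (x - y)" for x y
    using lipschitz_onD [OF L, of x y] by (simp add: dist_norm)
  define W where "W u s = y0 + exp (c * \<bar>s\<bar>) *\<^sub>R apply_bcontfun u s" for u :: "real \<Rightarrow>\<^sub>C 'a" and s
  have Wcont: "continuous_on UNIV (W u)" for u
    unfolding W_def by (intro continuous_intros) auto
  have "\<exists>G. G 0 = 0 \<and> (\<forall>t. (G has_vector_derivative F (W u t)) (at t))" for u
    by (rule antiderivative_on_line [of "\<lambda>t. F (W u t)"])
       (auto intro: continuous_on_compose2 [OF Fcont Wcont])
  then obtain I where I0: "\<And>u. I u 0 = 0"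
    and I: "\<And>u t. (I u has_vector_derivative F (W u t)) (at t)" by metis
  define V where "V u t = exp (- (c * \<bar>t\<bar>)) *\<^sub>R I u t" for u t
  have Vcont: "continuous_on UNIV (V u)" for u
    unfolding V_def
    by (intro continuous_intros)
       (use I in \<open>meson continuous_at_imp_continuous_on has_vector_derivative_continuous\<close>)
  have unweight: "norm (exp (- (c * \<bar>t\<bar>)) *\<^sub>R x) \<le> B"
    if "norm x \<le> B * exp (c * \<bar>t\<bar>)" for x :: 'a and B t
    using mult_left_mono [OF that, of "exp (- (c * \<bar>t\<bar>))"]
    by (simp add: exp_minus field_simps)
  have Vbound: "norm (V u t) \<le> (norm (F y0) + L * norm u) / c" for u t
    unfolding V_def
  proof (rule unweight, rule exponential_growth_bound [OF I I0 c])
    fix s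
    have "norm (F (W u s)) \<le> norm (F y0) + norm (F (W u s) - F y0)"
      by (metis add.commute diff_add_cancel norm_triangle_ineq)
    also have "norm (F (W u s) - F y0) \<le> L * (exp (c * \<bar>s\<bar>) * norm u)"
      using order_trans [OF Flip mult_left_mono [OF _ \<open>0 \<le> L\<close>]] norm_bounded [of u s]
      by (auto simp: W_def intro!: mult_left_mono)
    also have "norm (F y0) \<le> norm (F y0) * exp (c * \<bar>s\<bar>)"
      using c by (simp add: mult_le_cancel_left1)
    finally show "norm (F (W u s)) \<le> (norm (F y0) + L * norm u) * exp (c * \<bar>s\<bar>)"
      by (simp add: algebra_simps)
  qed
  define P where "P u = Bcontfun (V u)" for u
  have P: "apply_bcontfun (P u) = V u" for u
  proof -
    have "V u \<in> bcontfun"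
      using Vcont [of u] Vbound [of u] by (auto simp: bcontfun_def bounded_iff)
    then show ?thesis unfolding P_def by (rule Bcontfun_inverse)
  qed
  have contract: "dist (P u) (P w) \<le> 1 / 2 * dist u w" for u w
  proof (rule dist_bound)
    fix t
    have "norm (exp (- (c * \<bar>t\<bar>)) *\<^sub>R (I u t - I w t)) \<le> L * dist u w / c"
    proof (rule unweight, rule exponential_growth_bound [OF _ _ c])
      show "((\<lambda>t. I u t - I w t) has_vector_derivative F (W u t) - F (W w t)) (at t)" for t
        by (intro has_vector_derivative_diff I)
      show "I u 0 - I w 0 = 0" by (simp add: I0)
      fix s
      have "norm (F (W u s) - F (W w s)) \<le> L * norm (W u s - W w s)" by (rule Flip)
      also have "norm (W u s - W w s) = exp (c * \<bar>s\<bar>) * dist (u s) (w s)"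
        by (simp add: W_def dist_norm scaleR_diff_right [symmetric])
      also have "L * \<dots> \<le> L * (exp (c * \<bar>s\<bar>) * dist u w)"
        using \<open>0 \<le> L\<close> dist_bounded [of u s w] by (intro mult_left_mono) auto
      finally show "norm (F (W u s) - F (W w s)) \<le> L * dist u w * exp (c * \<bar>s\<bar>)"
        by (simp add: mult_ac)
    qed
    also have "L * dist u w / c \<le> 1 / 2 * dist u w"
    proof -
      have "L / c \<le> 1 / 2" using \<open>0 \<le> L\<close> by (simp add: c_def field_simps)
      from mult_right_mono [OF this zero_le_dist [of u w]] show ?thesis by simp
    qed
    finally show "dist (P u t) (P w t) \<le> 1 / 2 * dist u w"
      unfolding P V_def dist_norm scaleR_diff_right .
  qed
  then obtain u where u: "P u = u"
    using banach_fix_type [of "1/2" P] by auto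
  have Y: "W u t = y0 + I u t" for t
  proof -
    have "apply_bcontfun u t = V u t" using P [of u] u by simp
    then show ?thesis by (simp add: W_def V_def exp_minus)
  qed
  show thesis
  proof
    show "y0 + I u 0 = y0" by (simp add: I0)
    show "((\<lambda>t. y0 + I u t) has_vector_derivative F (y0 + I u t)) (at t)" for t
      using has_vector_derivative_add [OF has_vector_derivative_const I, of y0 u t] by (simp add: Y)
  qed
qed

text \<open>Gronwall's inequality for the squared norm, which is differentiable also where \<open>D\<close> vanishes.
The inhomogeneity \<open>\<epsilon>\<close> measures the distance between two differential equations.\<close>

lemma ode_comparison:
  fixes D :: "real \<Rightarrow> 'a::real_inner"
  assumes D: "\<And>t. t \<in> {0..b} \<Longrightarrow> (D has_vector_derivative D' t) (at t)"
    and bound: "\<And>t. t \<in> {0..b} \<Longrightarrow> norm (D' t) \<le> L * norm (D t) + \<epsilon>"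
    and "L \<ge> 0" "t \<in> {0..b}"
  shows "(norm (D t))\<^sup>2 \<le> ((norm (D 0))\<^sup>2 + \<epsilon>\<^sup>2) * exp ((2 * L + 1) * t)"
proof -
  define c where "c = 2 * L + 1"
  have c: "c \<ge> 1" using \<open>L \<ge> 0\<close> by (simp add: c_def)
  \<comment> \<open>Both \<open>\<epsilon>\<^sup>2\<close> and the constant \<open>c\<close> come from \<open>2 \<parallel>D\<parallel> \<epsilon> \<le> \<parallel>D\<parallel>\<^sup>2 + \<epsilon>\<^sup>2\<close>.\<close>
  define \<phi> where "\<phi> s = ((norm (D s))\<^sup>2 + \<epsilon>\<^sup>2) * exp (- (c * s))" for s
  have "\<phi> t \<le> \<phi> 0"
  proof (rule DERIV_nonpos_imp_nonincreasing [where f = \<phi> and a = 0 and b = t])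
    show "0 \<le> t" using assms by simp
    fix s assume s: "0 \<le> s" "s \<le> t"
    then have s': "s \<in> {0..b}" using assms by auto
    define d where "d = (2 * (D s \<bullet> D' s) - c * ((norm (D s))\<^sup>2 + \<epsilon>\<^sup>2)) * exp (- (c * s))"
    have "((\<lambda>s. D s \<bullet> D s) has_real_derivative 2 * (D s \<bullet> D' s)) (at s)"
      using bounded_bilinear.has_vector_derivative [OF bounded_bilinear_inner D [OF s'] D [OF s']]
      by (simp add: has_real_derivative_iff_has_vector_derivative inner_commute)
    then have "(\<phi> has_real_derivative d) (at s)"
      unfolding \<phi>_def power2_norm_eq_inner d_def
      by (auto intro!: derivative_eq_intros simp: algebra_simps)
    moreover have "d \<le> 0"
    proof -
      have "D s \<bullet> D' s \<le> norm (D s) * (L * norm (D s) + \<epsilon>)"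
        by (rule order_trans [OF norm_cauchy_schwarz mult_left_mono [OF bound [OF s']]]) simp
      moreover have "2 * (norm (D s) * \<epsilon>) \<le> (norm (D s))\<^sup>2 + \<epsilon>\<^sup>2"
        using sum_squares_bound [of "norm (D s)" \<epsilon>] by (simp add: mult.assoc)
      ultimately have "2 * (D s \<bullet> D' s) \<le> c * (norm (D s))\<^sup>2 + \<epsilon>\<^sup>2"
        by (simp add: c_def algebra_simps power2_eq_square)
      moreover have "\<epsilon>\<^sup>2 \<le> c * \<epsilon>\<^sup>2" using c by (simp add: mult_le_cancel_right1)
      ultimately have "2 * (D s \<bullet> D' s) - c * ((norm (D s))\<^sup>2 + \<epsilon>\<^sup>2) \<le> 0"
        by (simp add: algebra_simps)
      then show ?thesis unfolding d_def by (rule mult_nonpos_nonneg) simp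
    qed
    ultimately show "\<exists>y. (\<phi> has_real_derivative y) (at s) \<and> y \<le> 0" by blast
  qed
  then have "\<phi> t * exp (c * t) \<le> \<phi> 0 * exp (c * t)" by (rule mult_right_mono) simp
  then have "(norm (D t))\<^sup>2 + \<epsilon>\<^sup>2 \<le> ((norm (D 0))\<^sup>2 + \<epsilon>\<^sup>2) * exp (c * t)"
    by (simp add: \<phi>_def mult.assoc exp_add [symmetric])
  then show ?thesis unfolding c_def using zero_le_power2 [of \<epsilon>] by linarith
qed

lemma ode_unique_forward:
  fixes X Y :: "real \<Rightarrow> 'a::real_inner"
  assumes X: "\<And>t. t \<in> {0..b} \<Longrightarrow> (X has_vector_derivative F (X t)) (at t)"
    and Y: "\<And>t. t \<in> {0..b} \<Longrightarrow> (Y has_vector_derivative F (Y t)) (at t)"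
    and L: "L-lipschitz_on (X ` {0..b} \<union> Y ` {0..b}) F" and "X 0 = Y 0" "t \<in> {0..b}"
  shows "X t = Y t"
proof -
  have "(norm (X t - Y t))\<^sup>2 \<le> ((norm (X 0 - Y 0))\<^sup>2 + 0\<^sup>2) * exp ((2 * L + 1) * t)"
  proof (rule ode_comparison)
    fix s assume s: "s \<in> {0..b}"
    show "((\<lambda>t. X t - Y t) has_vector_derivative F (X s) - F (Y s)) (at s)"
      by (intro has_vector_derivative_diff X Y s)
    show "norm (F (X s) - F (Y s)) \<le> L * norm (X s - Y s) + 0"
      using lipschitz_onD [OF L, of "X s" "Y s"] s by (simp add: dist_norm)
  qed (use assms lipschitz_on_nonneg in auto)
  then show ?thesis using \<open>X 0 = Y 0\<close> by simp
qed

lemma has_vector_derivative_reverse: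
  assumes "(f has_vector_derivative f') (at (c - t))"
  shows "((\<lambda>t. f (c - t)) has_vector_derivative - f') (at t)"
proof -
  have "((\<lambda>t. c - t) has_vector_derivative - 1) (at t)"
    by (auto intro!: derivative_eq_intros)
  from vector_diff_chain_at [OF this assms] show ?thesis by (simp add: o_def)
qed

text \<open>For times before \<open>t0\<close>, reversing time turns the equation into the one with field \<open>- F\<close>.\<close>

lemma ode_unique_line:
  fixes X Y :: "real \<Rightarrow> 'a::real_inner"
  assumes X: "\<And>t. (X has_vector_derivative F (X t)) (at t)"
    and Y: "\<And>t. (Y has_vector_derivative F (Y t)) (at t)"
    and L: "L-lipschitz_on UNIV F" and eq: "X t0 = Y t0"
  shows "X = Y"
proof
  fix t
  have shift: "((\<lambda>s. Z (t0 + s)) has_vector_derivative F (Z (t0 + s))) (at s)"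
    if "\<And>t. (Z has_vector_derivative F (Z t)) (at t)" for Z :: "real \<Rightarrow> 'a" and s
  proof -
    have "((\<lambda>s. t0 + s) has_vector_derivative 1) (at s)"
      by (auto intro!: derivative_eq_intros)
    from vector_diff_chain_at [OF this that] show ?thesis by (simp add: o_def)
  qed
  have L': "L-lipschitz_on UNIV (\<lambda>x. - F x)"
    using L by (simp add: lipschitz_on_def dist_norm norm_minus_commute)
  show "X t = Y t"
  proof (cases "t \<ge> t0")
    case True
    have "X (t0 + (t - t0)) = Y (t0 + (t - t0))"
      by (rule ode_unique_forward [where b = "t - t0" and F = F and L = L])
         (use True eq shift X Y L in \<open>auto intro: lipschitz_on_subset\<close>)
    then show ?thesis by simp
  next
    case False
    have "X (t0 - (t0 - t)) = Y (t0 - (t0 - t))"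
      by (rule ode_unique_forward [where b = "t0 - t" and F = "\<lambda>x. - F x" and L = L])
         (use False eq X Y L' in \<open>auto intro: lipschitz_on_subset has_vector_derivative_reverse\<close>)
    then show ?thesis by simp
  qed
qed

section \<open>Zeros of a continuous map depending on a parameter\<close>

text \<open>The map \<open>x \<mapsto> x - f x\<close>, clamped to the box, has a fixed point by Brouwer's theorem. A coordinate
in which clamping is active would put the fixed point on a face, where the sign
condition forbids it.\<close>

theorem poincare_miranda:
  fixes f :: "'a::euclidean_space \<Rightarrow> 'a"
  assumes cont: "continuous_on (cbox l u) f" and ne: "cbox l u \<noteq> {}"
    and lower: "\<And>x i. x \<in> cbox l u \<Longrightarrow> i \<in> Basis \<Longrightarrow> x \<bullet> i = l \<bullet> i \<Longrightarrow> f x \<bullet> i \<le> 0"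
    and upper: "\<And>x i. x \<in> cbox l u \<Longrightarrow> i \<in> Basis \<Longrightarrow> x \<bullet> i = u \<bullet> i \<Longrightarrow> f x \<bullet> i \<ge> 0"
  obtains x where "x \<in> cbox l u" "f x = 0"
proof -
  have lu: "\<And>i. i \<in> Basis \<Longrightarrow> l \<bullet> i \<le> u \<bullet> i" using ne by (simp add: box_ne_empty)
  obtain x where x: "x \<in> cbox l u" and fixed: "clamp l u (x - f x) = x"
  proof (rule brouwer)
    show "compact (cbox l u)" "convex (cbox l u)" by auto
    show "continuous_on (cbox l u) (\<lambda>x. clamp l u (x - f x))"
      by (rule continuous_on_compose2 [OF clamp_continuous_on [where f = id and S = UNIV], simplified])
         (auto intro!: continuous_intros cont)
    show "(\<lambda>x. clamp l u (x - f x)) \<in> cbox l u \<rightarrow> cbox l u"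
      using lu by (auto intro!: clamp_in_interval)
  qed (use ne in auto)
  have "f x \<bullet> i = 0" if i: "i \<in> Basis" for i
  proof -
    have xi: "x \<bullet> i = (if (x - f x) \<bullet> i < l \<bullet> i then l \<bullet> i
        else if (x - f x) \<bullet> i \<le> u \<bullet> i then (x - f x) \<bullet> i else u \<bullet> i)"
      using arg_cong [OF fixed, of "\<lambda>x. x \<bullet> i"] lu i by (simp add: clamp_def)
    show ?thesis
      using xi lower [OF x i] upper [OF x i] unfolding inner_diff_left by (smt (verit))
  qed
  then have "f x = 0" by (subst euclidean_eq_iff) simp
  with x that show thesis by blast
qed

text \<open>If no component of the zero set met both ends of the parameter interval, the zero set would split
into two disjoint closed parts, one containing all zeros over \<open>\<alpha>\<close> and one containing all zeros over
\<open>\<beta>\<close>. A Urysohn function \<open>h\<close> equal to \<open>-1\<close> on the first part and to \<open>1\<close> on the second could then be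
adjoined to \<open>f\<close> as a further coordinate, and the Poincare-Miranda theorem would give a common
zero of \<open>f\<close> and \<open>h\<close>, although \<open>h\<close> has no zero among the zeros of \<open>f\<close>.\<close>

theorem continuum_of_zeros:
  fixes f :: "'a::euclidean_space \<times> real \<Rightarrow> 'a"
  assumes cont: "continuous_on (cbox l u \<times> {\<alpha>..\<beta>}) f" and ne: "cbox l u \<noteq> {}" and "\<alpha> < \<beta>"
    and lower: "\<And>x \<mu> i. x \<in> cbox l u \<Longrightarrow> \<mu> \<in> {\<alpha>..\<beta>} \<Longrightarrow> i \<in> Basis \<Longrightarrow> x \<bullet> i = l \<bullet> i \<Longrightarrow> f (x, \<mu>) \<bullet> i \<le> 0"
    and upper: "\<And>x \<mu> i. x \<in> cbox l u \<Longrightarrow> \<mu> \<in> {\<alpha>..\<beta>} \<Longrightarrow> i \<in> Basis \<Longrightarrow> x \<bullet> i = u \<bullet> i \<Longrightarrow> f (x, \<mu>) \<bullet> i \<ge> 0"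
  obtains C where "compact C" "connected C" "C \<subseteq> cbox l u \<times> {\<alpha>..\<beta>}"
    "\<forall>z\<in>C. f z = 0" "{\<alpha>..\<beta>} \<subseteq> snd ` C"
proof -
  define Q where "Q = cbox l u \<times> {\<alpha>..\<beta>}"
  define Z where "Z = {z \<in> Q. f z = 0}"
  have Qbox: "Q = cbox (l, \<alpha>) (u, \<beta>)" by (simp add: Q_def cbox_Pair_eq)
  have "compact Q" unfolding Qbox by (rule compact_cbox)
  have "closed Q" using \<open>compact Q\<close> by (rule compact_imp_closed)
  have contQ: "continuous_on Q f" using cont by (simp add: Q_def)
  have "closed Z"
    unfolding Z_def using continuous_closed_preimage_constant [OF contQ \<open>closed Q\<close>] by simp
  have "compact Z"
  proof -
    have "Q \<inter> Z = Z" by (auto simp: Z_def)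
    then show ?thesis using compact_Int_closed [OF \<open>compact Q\<close> \<open>closed Z\<close>] by simp
  qed
  define Z0 where "Z0 = {z \<in> Z. snd z = \<alpha>}"
  define Z1 where "Z1 = {z \<in> Z. snd z = \<beta>}"
  have slice: "compact {z \<in> Z. snd z = c}" for c
  proof -
    have "closed {z :: 'a \<times> real. snd z = c}"
      by (intro closed_Collect_eq continuous_intros)
    from compact_Int_closed [OF \<open>compact Z\<close> this] show ?thesis by (simp add: Int_def)
  qed
  have "\<exists>z\<in>Z0. \<exists>w\<in>Z1. w \<in> connected_component_set Z z"
  proof (rule ccontr)
    assume no: "\<not> ?thesis"
    \<comment> \<open>In a compact set, components are intersections of relatively clopen sets; finitely many such
sets then separate the zeros over \<open>\<alpha>\<close> from those over \<open>\<beta>\<close>.\<close>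
    have "\<exists>K. openin (top_of_set Z) K \<and> compact K \<and> z \<in> K \<and> K \<inter> Z1 = {}" if "z \<in> Z0" for z
    proof -
      have z: "z \<in> Z" using that by (simp add: Z0_def)
      let ?C = "connected_component_set Z z"
      have zC: "?C \<in> components Z" using z by (rule componentsI)
      have "compact ?C"
        using \<open>compact Z\<close> zC by (rule compact_components)
      moreover have "open (- Z1)"
        using slice [of \<beta>] by (simp add: Z1_def compact_imp_closed open_Compl)
      moreover have "?C \<subseteq> - Z1" using no that by blast
      ultimately obtain K where "openin (top_of_set Z) K" "compact K" "?C \<subseteq> K" "K \<subseteq> - Z1"
        using Sura_Bura_clopen_subset [OF closed_imp_locally_compact [OF \<open>closed Z\<close>] zC] by metis
      moreover have "z \<in> ?C" using z by simp
      ultimately show ?thesis by blast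
    qed
    then obtain K where K: "\<And>z. z \<in> Z0 \<Longrightarrow> openin (top_of_set Z) (K z)"
      "\<And>z. z \<in> Z0 \<Longrightarrow> compact (K z)" "\<And>z. z \<in> Z0 \<Longrightarrow> z \<in> K z" "\<And>z. z \<in> Z0 \<Longrightarrow> K z \<inter> Z1 = {}"
      by metis
    have "\<exists>T. \<forall>z\<in>Z0. open (T z) \<and> K z = Z \<inter> T z"
      using K(1) by (intro bchoice) (auto simp: openin_open)
    then obtain T where T: "\<And>z. z \<in> Z0 \<Longrightarrow> open (T z)" "\<And>z. z \<in> Z0 \<Longrightarrow> K z = Z \<inter> T z"
      by blast
    have "compact Z0" unfolding Z0_def by (rule slice)
    moreover have "Z0 \<subseteq> (\<Union>z\<in>Z0. T z)" using K(3) T(2) by blast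
    ultimately obtain I where I: "I \<subseteq> Z0" "finite I" "Z0 \<subseteq> (\<Union>z\<in>I. T z)"
      using compactE_image [of Z0 Z0 T] T(1) by metis
    define A where "A = (\<Union>z\<in>I. K z)"
    define B where "B = Z - (\<Union>z\<in>I. T z)"
    have AZ: "A = Z \<inter> (\<Union>z\<in>I. T z)" using I(1) T(2) unfolding A_def by blast
    have "closed A" unfolding A_def
    proof (intro closed_UN ballI)
      show "closed (K z)" if "z \<in> I" for z
        using I(1) K(2) that by (meson compact_imp_closed subsetD)
    qed (use I in auto)
    have "closed B" unfolding B_def
    proof (intro closed_Diff open_UN ballI \<open>closed Z\<close>)
      show "open (T z)" if "z \<in> I" for z using I(1) T(1) that by blast
    qed
    have "Z0 \<subseteq> Z" "Z1 \<subseteq> Z" by (simp_all add: Z0_def Z1_def)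
    have "Z0 \<subseteq> A" unfolding AZ using I(3) \<open>Z0 \<subseteq> Z\<close> by blast
    have "Z1 \<subseteq> B"
    proof
      fix z assume "z \<in> Z1"
      then have "z \<in> Z" using \<open>Z1 \<subseteq> Z\<close> by blast
      moreover have "z \<notin> T w" if "w \<in> I" for w
        using that I(1) K(4) [of w] T(2) [of w] \<open>z \<in> Z\<close> \<open>z \<in> Z1\<close> by blast
      ultimately show "z \<in> B" by (simp add: B_def)
    qed
    \<comment> \<open>Adding the bottom and the top of the box gives \<open>h\<close> the signs that the last coordinate needs.\<close>
    define S0 where "S0 = A \<union> cbox l u \<times> {\<alpha>}"
    define S1 where "S1 = B \<union> cbox l u \<times> {\<beta>}"
    have "closed S0" "closed S1"
      unfolding S0_def S1_def using \<open>closed A\<close> \<open>closed B\<close> by (auto intro!: closed_Un closed_Times)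
    moreover have "S0 \<inter> S1 = {}"
    proof -
      have "A \<inter> B = {}" by (auto simp: AZ B_def)
      moreover have "A \<inter> cbox l u \<times> {\<beta>} = {}"
        using \<open>Z1 \<subseteq> B\<close> by (auto simp: AZ B_def Z1_def)
      moreover have "cbox l u \<times> {\<alpha>} \<inter> B = {}"
        using \<open>Z0 \<subseteq> A\<close> by (auto simp: AZ B_def Z0_def)
      ultimately show ?thesis using \<open>\<alpha> < \<beta>\<close> by (auto simp: S0_def S1_def)
    qed
    ultimately obtain h :: "'a \<times> real \<Rightarrow> real" where h: "continuous_on UNIV h"
      "\<And>z. z \<in> S0 \<Longrightarrow> h z = -1" "\<And>z. z \<in> S1 \<Longrightarrow> h z = 1"
      using Urysohn [of S0 S1 "-1::real" 1] by metis
    obtain z where z: "z \<in> cbox (l, \<alpha>) (u, \<beta>)" "(f z, h z) = 0"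
    proof (rule poincare_miranda)
      show "continuous_on (cbox (l, \<alpha>) (u, \<beta>)) (\<lambda>z. (f z, h z))"
        using contQ h(1) unfolding Qbox
        by (intro continuous_intros) (auto intro: continuous_on_subset)
      show "cbox (l, \<alpha>) (u, \<beta>) \<noteq> {}" using ne \<open>\<alpha> < \<beta>\<close> unfolding Qbox [symmetric] Q_def by auto
    next
      fix z i :: "'a \<times> real" assume z: "z \<in> cbox (l, \<alpha>) (u, \<beta>)" and i: "i \<in> Basis"
      then have zQ: "fst z \<in> cbox l u" "snd z \<in> {\<alpha>..\<beta>}" unfolding Qbox [symmetric] Q_def by auto
      show "(f z, h z) \<bullet> i \<le> 0" if eq: "z \<bullet> i = (l, \<alpha>) \<bullet> i"
      proof -
        consider j where "j \<in> Basis" "i = (j, 0)" | "i = (0, 1)" using i by (auto simp: Basis_prod_def)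
        then show ?thesis
        proof cases
          case 1 then show ?thesis using lower [OF zQ 1(1)] eq by (cases z) auto
        next
          case 2 then show ?thesis using h(2) [of z] eq zQ by (cases z) (auto simp: S0_def)
        qed
      qed
      show "(f z, h z) \<bullet> i \<ge> 0" if eq: "z \<bullet> i = (u, \<beta>) \<bullet> i"
      proof -
        consider j where "j \<in> Basis" "i = (j, 0)" | "i = (0, 1)" using i by (auto simp: Basis_prod_def)
        then show ?thesis
        proof cases
          case 1 then show ?thesis using upper [OF zQ 1(1)] eq by (cases z) auto
        next
          case 2 then show ?thesis using h(3) [of z] eq zQ by (cases z) (auto simp: S1_def)
        qed
      qed
    qed
    then have "z \<in> Z" "h z = 0" by (auto simp: Z_def Qbox zero_prod_def)
    then have "z \<in> A \<or> z \<in> B" by (auto simp: AZ B_def)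
    then have "h z = -1 \<or> h z = 1" using h(2,3) [of z] by (auto simp: S0_def S1_def)
    then show False using \<open>h z = 0\<close> by simp
  qed
  then obtain z w where z: "z \<in> Z0" and w: "w \<in> Z1" "w \<in> connected_component_set Z z" by blast
  define C where "C = connected_component_set Z z"
  have zC: "connected_component_set Z z \<in> components Z"
    using z by (intro componentsI) (simp add: Z0_def)
  show thesis
  proof
    show "compact C" unfolding C_def using \<open>compact Z\<close> zC by (rule compact_components)
    show "connected C" unfolding C_def by (rule connected_connected_component)
    have "C \<subseteq> Z" unfolding C_def by (rule connected_component_subset)
    then show "C \<subseteq> cbox l u \<times> {\<alpha>..\<beta>}" "\<forall>z\<in>C. f z = 0" by (auto simp: Z_def Q_def)
    have "connected (snd ` C)"
      using \<open>connected C\<close> by (intro connected_continuous_image continuous_intros)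
    moreover have "z \<in> C" using z by (auto simp: C_def Z0_def)
    then have "\<alpha> \<in> snd ` C" using z by (force simp: Z0_def)
    moreover have "\<beta> \<in> snd ` C" using w by (force simp: C_def Z1_def)
    ultimately show "{\<alpha>..\<beta>} \<subseteq> snd ` C" by (rule connected_contains_Icc)
  qed
qed

section \<open>Closed curves described by a polar angle\<close>

text \<open>The angle is defined by integrating the angular velocity. The curve is then rotated back by this
angle: in the rotating frame its coordinates \<open>u\<close> and \<open>w\<close>, divided by the distance to
the origin, have zero derivative, so the direction stays that of the positive axis.\<close>

lemma polar_angle:
  fixes x y p q :: "real \<Rightarrow> real"
  assumes x: "\<And>t. (x has_real_derivative p t) (at t)" and y: "\<And>t. (y has_real_derivative q t) (at t)"
    and p: "continuous_on UNIV p" and q: "continuous_on UNIV q"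
    and pos: "\<And>t. 0 < (x t)\<^sup>2 + (y t)\<^sup>2" and start: "0 < x 0" "y 0 = 0"
  obtains \<Theta> where "\<Theta> 0 = 0"
    "\<And>t. (\<Theta> has_real_derivative (x t * q t - y t * p t) / ((x t)\<^sup>2 + (y t)\<^sup>2)) (at t)"
    "\<And>t. x t = sqrt ((x t)\<^sup>2 + (y t)\<^sup>2) * cos (\<Theta> t)"
    "\<And>t. y t = sqrt ((x t)\<^sup>2 + (y t)\<^sup>2) * sin (\<Theta> t)"
proof -
  have cx: "continuous_on UNIV x" and cy: "continuous_on UNIV y"
    using x y by (meson DERIV_isCont continuous_at_imp_continuous_on)+
  have "continuous_on UNIV (\<lambda>t. (x t * q t - y t * p t) / ((x t)\<^sup>2 + (y t)\<^sup>2))"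
    by (intro continuous_intros cx cy p q) (use pos in \<open>auto simp: less_le\<close>)
  from antiderivative_on_line [OF this] obtain \<Theta> where \<Theta>0: "\<Theta> 0 = 0"
    and \<Theta>: "\<And>t. (\<Theta> has_real_derivative (x t * q t - y t * p t) / ((x t)\<^sup>2 + (y t)\<^sup>2)) (at t)"
    unfolding has_real_derivative_iff_has_vector_derivative by metis
  define N where "N t = (x t)\<^sup>2 + (y t)\<^sup>2" for t
  have N: "N t > 0" for t using pos by (simp add: N_def)
  have dN: "(N has_real_derivative 2 * (x t * p t + y t * q t)) (at t)" for t
    unfolding N_def by (auto intro!: derivative_eq_intros x y)
  define J where "J t = inverse (sqrt (N t))" for t
  have dJ: "(J has_real_derivative - (x t * p t + y t * q t) / N t * J t) (at t)" for t
    unfolding J_def using N [of t]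
    by (auto intro!: derivative_eq_intros dN simp: field_simps power2_eq_square)
  define u where "u t = x t * cos (\<Theta> t) + y t * sin (\<Theta> t)" for t
  define w where "w t = y t * cos (\<Theta> t) - x t * sin (\<Theta> t)" for t
  have d\<Theta>: "(\<Theta> has_real_derivative (x t * q t - y t * p t) / N t) (at t)" for t
    using \<Theta> by (simp add: N_def)
  have du: "(u has_real_derivative u t * (x t * p t + y t * q t) / N t) (at t)" for t
  proof -
    have "(u has_real_derivative p t * cos (\<Theta> t) + q t * sin (\<Theta> t)
        + w t * ((x t * q t - y t * p t) / N t)) (at t)"
      unfolding u_def w_def
      by (auto intro!: derivative_eq_intros x y d\<Theta> simp: algebra_simps add_divide_distrib diff_divide_distrib)
    also have "p t * cos (\<Theta> t) + q t * sin (\<Theta> t) + w t * ((x t * q t - y t * p t) / N t)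
        = u t * (x t * p t + y t * q t) / N t"
      using N [of t] by (simp add: field_simps) (simp add: N_def u_def w_def power2_eq_square algebra_simps)
    finally show ?thesis .
  qed
  have dw: "(w has_real_derivative w t * (x t * p t + y t * q t) / N t) (at t)" for t
  proof -
    have "(w has_real_derivative q t * cos (\<Theta> t) - p t * sin (\<Theta> t)
        - u t * ((x t * q t - y t * p t) / N t)) (at t)"
      unfolding u_def w_def
      by (auto intro!: derivative_eq_intros x y d\<Theta> simp: algebra_simps add_divide_distrib diff_divide_distrib)
    also have "q t * cos (\<Theta> t) - p t * sin (\<Theta> t) - u t * ((x t * q t - y t * p t) / N t)
        = w t * (x t * p t + y t * q t) / N t"
      using N [of t] by (simp add: field_simps) (simp add: N_def u_def w_def power2_eq_square algebra_simps)
    finally show ?thesis .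
  qed
  have const: "f t * J t = f 0 * J 0"
    if f: "\<And>t. (f has_real_derivative f t * (x t * p t + y t * q t) / N t) (at t)" for f t
  proof -
    have "((\<lambda>t. f t * J t) has_real_derivative 0) (at t)" for t
    proof -
      have "((\<lambda>t. f t * J t) has_real_derivative f t * (x t * p t + y t * q t) / N t * J t
          + - (x t * p t + y t * q t) / N t * J t * f t) (at t)"
        using DERIV_mult [OF f dJ, of t] by (simp add: mult.commute)
      moreover have "f t * (x t * p t + y t * q t) / N t * J t
          + - (x t * p t + y t * q t) / N t * J t * f t = 0"
        using N [of t] by (simp add: field_simps)
      ultimately show ?thesis by simp
    qed
    then show ?thesis by (intro DERIV_isconst_all) auto
  qed
  have J: "J t > 0" for t using N by (simp add: J_def)
  have "w t = 0" for t using const [OF dw, of t] start \<Theta>0 J [of t] by (simp add: w_def)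
  moreover have "u t = sqrt (N t)" for t
    using const [OF du, of t] start \<Theta>0 N [of t] by (simp add: u_def J_def N_def field_simps)
  moreover have "x t = u t * cos (\<Theta> t) - w t * sin (\<Theta> t)" "y t = u t * sin (\<Theta> t) + w t * cos (\<Theta> t)" for t
  proof -
    have sc: "(sin (\<Theta> t))\<^sup>2 = 1 - (cos (\<Theta> t))\<^sup>2" by (rule sin_squared_eq)
    show "x t = u t * cos (\<Theta> t) - w t * sin (\<Theta> t)" "y t = u t * sin (\<Theta> t) + w t * cos (\<Theta> t)"
      using sc unfolding u_def w_def by (algebra)+
  qed
  ultimately show thesis using that [OF \<Theta>0 \<Theta>] by (simp add: N_def)
qed

text \<open>Each ray from the origin meets the curve exactly once, so the radial projection is a
homeomorphism from the trace onto the unit circle. It is not homotopic to a constant, as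
the circle is not contractible, and by Borsuk's criterion the origin lies in a bounded component
of the complement.\<close>

theorem polar_closed_curve:
  fixes R :: "real \<Rightarrow> real \<times> real"
  assumes cont: "continuous_on UNIV R" "continuous_on UNIV \<Theta>" and mono: "strict_mono \<Theta>"
    and polar: "\<And>t. R t = norm (R t) *\<^sub>R (cos (\<Theta> t), sin (\<Theta> t))" and ne: "\<And>t. R t \<noteq> 0"
    and P: "P > 0" "\<Theta> 0 = 0" "\<Theta> P = 2 * pi" "R P = R 0"
  shows "simple_closed_curve (R ` {0..P})" and "0 \<in> inside (R ` {0..P})"
proof -
  define S where "S = R ` {0..P}"
  define h :: "real \<times> real \<Rightarrow> real \<times> real" where "h z = inverse (norm (z - 0)) *\<^sub>R (z - 0)" for z
  have hR: "h (R t) = (cos (\<Theta> t), sin (\<Theta> t))" for t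
    using ne [of t] arg_cong [OF polar [of t], of "\<lambda>z. inverse (norm (R t)) *\<^sub>R z"]
    by (simp add: h_def)
  \<comment> \<open>Two distinct times of the period whose points lie on a common ray have angles that differ by a full turn, so they are its endpoints.\<close>
  have same: "a = 0 \<and> b = P" if eq: "h (R a) = h (R b)" and ab: "0 \<le> a" "a < b" "b \<le> P" for a b
  proof -
    have "sin (\<Theta> b) = sin (\<Theta> a) \<and> cos (\<Theta> b) = cos (\<Theta> a)" using eq by (simp add: hR)
    then obtain n :: int where n: "\<Theta> b = \<Theta> a + 2 * pi * n" unfolding sin_cos_eq_iff by blast
    have lt: "\<Theta> a < \<Theta> b" using mono ab by (simp add: strict_monoD)
    have "0 \<le> \<Theta> a" "\<Theta> b \<le> 2 * pi"
      using ab P(2,3) strict_mono_less_eq [OF mono, of 0 a] strict_mono_less_eq [OF mono, of b P] by auto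
    moreover have "n \<ge> 1"
      using lt n by (smt (verit) mult_nonneg_nonpos of_int_le_0_iff pi_gt_zero)
    then have "2 * pi * 1 \<le> 2 * pi * n" by (intro mult_left_mono) auto
    ultimately have "\<Theta> a = \<Theta> 0" "\<Theta> b = \<Theta> P" using n P(2,3) by linarith+
    then show ?thesis using mono by (simp add: strict_mono_eq)
  qed
  have "simple_path (\<lambda>u. R (P * u))"
    unfolding simple_path_def loop_free_def path_def
  proof (intro conjI ballI impI)
    show "continuous_on {0..1} (\<lambda>u. R (P * u))"
      by (rule continuous_on_compose2 [OF cont(1)]) (auto intro!: continuous_intros)
    fix a b :: real assume ab: "a \<in> {0..1}" "b \<in> {0..1}" and eq: "R (P * a) = R (P * b)"
    have range: "0 \<le> P * a" "P * a \<le> P" "0 \<le> P * b" "P * b \<le> P"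
      using ab P(1) by (auto simp: mult_left_le)
    consider "a = b" | "a < b" | "b < a" by linarith
    then show "a = b \<or> a = 0 \<and> b = 1 \<or> a = 1 \<and> b = 0"
    proof cases
      case 2
      then have "P * a = 0 \<and> P * b = P" using range P(1) eq by (intro same) auto
      then show ?thesis using P(1) by simp
    next
      case 3
      then have "P * b = 0 \<and> P * a = P" using range P(1) eq by (intro same) auto
      then show ?thesis using P(1) by simp
    qed simp
  qed
  moreover have "(\<lambda>u. R (P * u)) ` {0..1} = S"
  proof -
    have "(*) P ` {0..1} = {0..P}" using P(1) by (simp add: image_mult_atLeastAtMost)
    then show ?thesis unfolding S_def by (metis image_image)
  qed
  ultimately show "simple_closed_curve (R ` {0..P})"
    using P(4) unfolding simple_closed_curve_def S_def
    by (intro exI [of _ "\<lambda>u. R (P * u)"]) (auto simp: pathfinish_def pathstart_def path_image_def)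
  have "compact S"
    unfolding S_def by (intro compact_continuous_image continuous_on_subset [OF cont(1)]) auto
  have "0 \<notin> S" using ne by (metis S_def imageE)
  have "continuous_on S h"
    unfolding h_def using \<open>0 \<notin> S\<close> by (intro continuous_intros) auto
  have inj: "inj_on h S"
  proof (rule inj_onI)
    fix z w assume "z \<in> S" "w \<in> S" and eq: "h z = h w"
    then obtain a b where ab: "a \<in> {0..P}" "b \<in> {0..P}" "z = R a" "w = R b" by (auto simp: S_def)
    consider "a = b" | "a < b" | "b < a" by linarith
    then show "z = w"
    proof cases
      case 2 then show ?thesis using same [of a b] eq ab P(4) by auto
    next
      case 3 then show ?thesis using same [of b a] eq ab P(4) by auto
    qed (use ab in simp)
  qed
  have onto: "h ` S = sphere 0 1"
  proof
    show "h ` S \<subseteq> sphere 0 1" by (auto simp: S_def hR norm_Pair)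
    show "sphere 0 1 \<subseteq> h ` S"
    proof
      fix z :: "real \<times> real" assume z: "z \<in> sphere 0 1"
      then have "(fst z)\<^sup>2 + (snd z)\<^sup>2 = 1" by (cases z) (simp add: norm_Pair)
      then obtain \<tau> where \<tau>: "0 \<le> \<tau>" "\<tau> < 2 * pi" "fst z = cos \<tau>" "snd z = sin \<tau>"
        by (rule sincos_total_2pi)
      obtain t where t: "0 \<le> t" "t \<le> P" "\<Theta> t = \<tau>"
        using IVT' [of \<Theta> 0 \<tau> P] \<tau> P continuous_on_subset [OF cont(2)] by auto
      have "h (R t) = z" using \<tau> t by (simp add: hR prod_eq_iff)
      then show "z \<in> h ` S" using t by (auto simp: S_def)
    qed
  qed
  obtain k where k: "homeomorphism S (sphere 0 1) h k"
    using homeomorphism_compact [OF \<open>compact S\<close> \<open>continuous_on S h\<close> onto inj] by blast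
  have "\<not> (\<exists>c. homotopic_with_canon (\<lambda>x. True) S (sphere 0 1) h (\<lambda>x. c))"
  proof
    assume "\<exists>c. homotopic_with_canon (\<lambda>x. True) S (sphere 0 1) h (\<lambda>x. c)"
    then obtain c where "homotopic_with_canon (\<lambda>x. True) S (sphere 0 1) h (\<lambda>x. c)" ..
    then have "homotopic_with_canon (\<lambda>x. True) (sphere 0 1) (sphere 0 1) (h \<circ> k) ((\<lambda>x. c) \<circ> k)"
      using k by (intro homotopic_with_compose_continuous_right) (auto simp: homeomorphism_def)
    then have "homotopic_with_canon (\<lambda>x. True) (sphere 0 1) (sphere 0 1) id (\<lambda>x. c)"
      by (rule homotopic_with_eq) (use k in \<open>auto simp: homeomorphism_def\<close>)
    then have "contractible (sphere (0::real \<times> real) 1)" unfolding contractible_def by blast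
    then show False by (simp add: contractible_sphere)
  qed
  then show "0 \<in> inside (R ` {0..P})"
    using Borsuk_map_essential_bounded_component [OF \<open>compact S\<close> \<open>0 \<notin> S\<close>] \<open>0 \<notin> S\<close>
    unfolding inside_def h_def S_def by simp
qed

section \<open>Second order equations and their maximal solutions\<close>

text \<open>The first order system on positions and velocities that is equivalent to \<open>r'' = h r\<close>.\<close>

definition phase_field :: "(plane \<Rightarrow> plane) \<Rightarrow> plane \<times> plane \<Rightarrow> plane \<times> plane" where
  "phase_field h z = (snd z, h (fst z))"

lemma phase_field_lipschitz:
  assumes "L-lipschitz_on (fst ` S) h"
  shows "(L + 1)-lipschitz_on S (phase_field h)"
proof (rule lipschitz_onI)
  show "0 \<le> L + 1" using lipschitz_on_nonneg [OF assms] by simp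
  fix z w assume zw: "z \<in> S" "w \<in> S"
  have "dist (phase_field h z) (phase_field h w) \<le> dist (snd z) (snd w) + dist (h (fst z)) (h (fst w))"
    unfolding phase_field_def dist_Pair_Pair by (rule sqrt_sum_squares_le_sum) auto
  also have "dist (h (fst z)) (h (fst w)) \<le> L * dist (fst z) (fst w)"
    using zw by (intro lipschitz_onD [OF assms]) auto
  also have "\<dots> \<le> L * dist z w"
    using lipschitz_on_nonneg [OF assms] by (intro mult_left_mono dist_fst_le)
  also have "dist (snd z) (snd w) \<le> dist z w" by (rule dist_snd_le)
  finally show "dist (phase_field h z) (phase_field h w) \<le> (L + 1) * dist z w"
    by (simp add: algebra_simps)
qed

lemma has_vector_derivative_fst: "(Y has_vector_derivative d) F \<Longrightarrow> ((\<lambda>t. fst (Y t)) has_vector_derivative fst d) F"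
  and has_vector_derivative_snd: "(Y has_vector_derivative d) F \<Longrightarrow> ((\<lambda>t. snd (Y t)) has_vector_derivative snd d) F"
  by (auto intro: bounded_linear.has_vector_derivative bounded_linear_fst bounded_linear_snd)

text \<open>The compact set need not be convex, so the mean value theorem does not suffice; a locally
Lipschitz function is Lipschitz on every compact set.\<close>

lemma C1_on_lipschitz_on_compact:
  assumes "C1_on U f" "open U" "compact K" "K \<subseteq> U"
  obtains L where "L-lipschitz_on K f"
proof -
  obtain f' :: "plane \<Rightarrow> plane \<Rightarrow>\<^sub>L plane" where f': "\<And>p. p \<in> U \<Longrightarrow> (f has_derivative blinfun_apply (f' p)) (at p)"
    "continuous_on U f'" using assms(1) by (auto simp: C1_on_def)
  have "local_lipschitz (UNIV :: real set) U (\<lambda>_. f)"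
  proof (rule c1_implies_local_lipschitz)
    show "continuous_on (UNIV \<times> U) (\<lambda>z :: real \<times> plane. f' (snd z))"
      by (rule continuous_on_compose2 [OF f'(2)]) (auto intro: continuous_intros)
  qed (use f' assms(2) in auto)
  then have "local_lipschitz {0 :: real} K (\<lambda>_. f)"
    using assms(4) by (auto intro: local_lipschitz_subset)
  from local_lipschitz_compact_implies_lipschitz [OF this assms(3)]
  show thesis using that by auto
qed

lemma solves_ivp_phase:
  assumes "solves_ivp U g x v \<mu> J r"
  obtains Y where "Y 0 = (x, v)" "\<And>t. fst (Y t) = r t" "\<And>t. t \<in> J \<Longrightarrow> r t \<in> U"
    "\<And>t. t \<in> J \<Longrightarrow> (Y has_vector_derivative phase_field (\<lambda>r. g r \<mu>) (Y t)) (at t)"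
proof -
  obtain r' where r': "r 0 = x" "r' 0 = v" "\<And>t. t \<in> J \<Longrightarrow> r t \<in> U"
    "\<And>t. t \<in> J \<Longrightarrow> (r has_vector_derivative r' t) (at t)"
    "\<And>t. t \<in> J \<Longrightarrow> (r' has_vector_derivative g (r t) \<mu>) (at t)"
    using assms unfolding solves_ivp_def by blast
  show thesis
    by (rule that [of "\<lambda>t. (r t, r' t)"])
       (use r' in \<open>auto simp: phase_field_def intro: has_vector_derivative_Pair\<close>)
qed

lemma phase_solves_ivp:
  assumes Y: "\<And>t. (Y has_vector_derivative phase_field (\<lambda>r. g r \<mu>) (Y t)) (at t)"
    and "Y 0 = (x, v)" "\<And>t. fst (Y t) \<in> U"
  shows "solves_ivp U g x v \<mu> UNIV (\<lambda>t. fst (Y t))"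
  unfolding solves_ivp_def
proof (intro conjI exI [of _ "\<lambda>t. snd (Y t)"] ballI)
  show "((\<lambda>t. fst (Y t)) has_vector_derivative snd (Y t)) (at t)"
    "((\<lambda>t. snd (Y t)) has_vector_derivative g (fst (Y t)) \<mu>) (at t)" for t
    using has_vector_derivative_fst [OF Y, of t] has_vector_derivative_snd [OF Y, of t]
    by (auto simp: phase_field_def)
qed (use assms in \<open>auto simp: is_interval_def\<close>)

lemma solves_ivp_reverse:
  assumes "solves_ivp U g x v \<mu> J r"
  shows "solves_ivp U g x (- v) \<mu> (uminus ` J) (\<lambda>t. r (- t))"
proof -
  obtain r' where J: "open J" "is_interval J" "0 \<in> J" and r': "r 0 = x" "r' 0 = v" "\<And>t. t \<in> J \<Longrightarrow> r t \<in> U"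
    "\<And>t. t \<in> J \<Longrightarrow> (r has_vector_derivative r' t) (at t)"
    "\<And>t. t \<in> J \<Longrightarrow> (r' has_vector_derivative g (r t) \<mu>) (at t)"
    using assms unfolding solves_ivp_def by blast
  show ?thesis
    unfolding solves_ivp_def
  proof (intro conjI exI [of _ "\<lambda>t. - r' (- t)"] ballI)
    show "open (uminus ` J)" using J(1) by (rule open_negations)
    show "is_interval (uminus ` J)" using J(2) by simp
    show "0 \<in> uminus ` J" using J(3) by force
    fix t assume "t \<in> uminus ` J"
    then have t: "- t \<in> J" by auto
    show "r (- t) \<in> U" using r'(3) t by simp
    show "((\<lambda>t. r (- t)) has_vector_derivative - r' (- t)) (at t)"
      using has_vector_derivative_reverse [of r _ 0 t] r'(4) [OF t] by simp
    show "((\<lambda>t. - r' (- t)) has_vector_derivative g (r (- t)) \<mu>) (at t)"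
      using has_vector_derivative_minus [OF has_vector_derivative_reverse [of r' _ 0 t]] r'(5) [OF t] by simp
  qed (use r' in auto)
qed

text \<open>On a compact time interval both solutions stay in a compact subset of \<open>U\<close>, where the force is
Lipschitz. Negative times reduce to positive ones because time reversal preserves the equation.\<close>

lemma solves_ivp_unique:
  assumes g: "C1_on U (\<lambda>r. g r \<mu>)" "open U"
    and r1: "solves_ivp U g x v \<mu> J1 r1" and r2: "solves_ivp U g x v \<mu> J2 r2"
    and t: "t \<in> J1" "t \<in> J2"
  shows "r1 t = r2 t"
proof -
  have forward: "r1 t = r2 t"
    if r1: "solves_ivp U g x v \<mu> J1 r1" and r2: "solves_ivp U g x v \<mu> J2 r2"
      and t: "t \<in> J1" "t \<in> J2" "0 \<le> t" for r1 r2 J1 J2 t v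
  proof -
    obtain Y where Y: "Y 0 = (x, v)" "\<And>t. fst (Y t) = r1 t" "\<And>t. t \<in> J1 \<Longrightarrow> r1 t \<in> U"
      "\<And>t. t \<in> J1 \<Longrightarrow> (Y has_vector_derivative phase_field (\<lambda>r. g r \<mu>) (Y t)) (at t)"
      using solves_ivp_phase [OF r1] by metis
    obtain Z where Z: "Z 0 = (x, v)" "\<And>t. fst (Z t) = r2 t" "\<And>t. t \<in> J2 \<Longrightarrow> r2 t \<in> U"
      "\<And>t. t \<in> J2 \<Longrightarrow> (Z has_vector_derivative phase_field (\<lambda>r. g r \<mu>) (Z t)) (at t)"
      using solves_ivp_phase [OF r2] by metis
    have "is_interval J1" "is_interval J2" "0 \<in> J1" "0 \<in> J2"
      using r1 r2 unfolding solves_ivp_def by simp_all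
    then have J1: "{0..t} \<subseteq> J1" and J2: "{0..t} \<subseteq> J2"
      using t unfolding is_interval_1 subset_iff atLeastAtMost_iff by blast+
    have "compact (Y ` {0..t})" "compact (Z ` {0..t})"
      using J1 J2 Y(4) Z(4)
      by (auto intro!: compact_continuous_image continuous_at_imp_continuous_on has_vector_derivative_continuous)
    then have "compact (Y ` {0..t} \<union> Z ` {0..t})" by (rule compact_Un)
    then have "compact (fst ` (Y ` {0..t} \<union> Z ` {0..t}))"
      by (rule compact_continuous_image [OF continuous_on_fst [OF continuous_on_id]])
    moreover have "fst ` (Y ` {0..t} \<union> Z ` {0..t}) \<subseteq> U" using Y Z J1 J2 by auto
    ultimately obtain L where L: "L-lipschitz_on (fst ` (Y ` {0..t} \<union> Z ` {0..t})) (\<lambda>r. g r \<mu>)"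
      using C1_on_lipschitz_on_compact [where f = "\<lambda>r. g r \<mu>", OF g] by metis
    have "Y t = Z t"
      by (rule ode_unique_forward [OF _ _ phase_field_lipschitz [OF L]]) (use Y Z J1 J2 t in auto)
    then show ?thesis using Y(2) Z(2) by metis
  qed
  show ?thesis
  proof (cases "0 \<le> t")
    case True then show ?thesis using forward r1 r2 t by blast
  next
    case False
    have "r1 (- (- t)) = r2 (- (- t))"
      by (rule forward [OF solves_ivp_reverse [OF r1] solves_ivp_reverse [OF r2]]) (use False t in auto)
    then show ?thesis by simp
  qed
qed

lemma sol_eq_global_solution:
  assumes g: "C1_on U (\<lambda>r. g r \<mu>)" "open U" and r: "solves_ivp U g x v \<mu> UNIV r"
  shows "sol_domain U g x v \<mu> = UNIV" and "sol U g x v \<mu> = r"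
proof -
  show "sol_domain U g x v \<mu> = UNIV" using r unfolding sol_domain_def by blast
  show "sol U g x v \<mu> = r"
    unfolding sol_def
  proof (intro ext the_equality)
    show "\<exists>J r'. solves_ivp U g x v \<mu> J r' \<and> t \<in> J \<and> r t = r' t" for t using r by blast
    show "y = r t" if y: "\<exists>J r'. solves_ivp U g x v \<mu> J r' \<and> t \<in> J \<and> y = r' t" for t y
    proof -
      obtain J r' where r': "solves_ivp U g x v \<mu> J r'" "t \<in> J" "y = r' t" using y by blast
      then show ?thesis
        using solves_ivp_unique [where g = g and \<mu> = \<mu> and U = U, OF g r'(1) r r'(2)] by simp
    qed
  qed
qed

lemma periodic_value_in_period:
  fixes f :: "real \<Rightarrow> 'b"
  assumes "\<And>t. f (t + P) = f t" "P > 0"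
  obtains t' where "t' \<in> {0..P}" "f t' = f t"
proof -
  interpret periodic_fun_simple f P by unfold_locales (rule assms)
  let ?n = "\<lfloor>t / P\<rfloor>"
  have "f (t - of_int ?n * P) = f t" by (rule minus_of_int)
  moreover have "of_int ?n * P \<le> t" "t \<le> (of_int ?n + 1) * P"
    using floor_divide_lower [OF assms(2), of t] floor_divide_upper [OF assms(2), of t] by auto
  ultimately show thesis using that [of "t - of_int ?n * P"] by (auto simp: algebra_simps)
qed

text \<open>The properties required of the orbits, stated for a given global solution \<open>r\<close> instead of the maximal
solution \<open>sol\<close>, with which \<open>r\<close> is identified by uniqueness.\<close>

definition symmetric_orbit ::
  "plane set \<Rightarrow> (plane \<Rightarrow> real \<Rightarrow> plane) \<Rightarrow> plane \<Rightarrow> plane \<Rightarrow> real \<Rightarrow> (real \<Rightarrow> plane) \<Rightarrow> bool" where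
  "symmetric_orbit U g x v \<mu> r \<longleftrightarrow>
     solves_ivp U g x v \<mu> UNIV r \<and> (\<exists>T>0. \<forall>t. r (t + T) = r t) \<and>
     simple_closed_curve (range r) \<and> reflect1 ` range r = range r \<and> reflect2 ` range r = range r \<and>
     0 \<in> inside (range r)"

lemma symmetric_orbit_sol:
  assumes g: "C1_on U (\<lambda>r. g r \<mu>)" "open U" and r: "symmetric_orbit U g x v \<mu> r"
  shows "periodic_sol U g x v \<mu> \<and> simple_closed_curve (sol_trace U g x v \<mu>) \<and>
    reflect1 ` sol_trace U g x v \<mu> = sol_trace U g x v \<mu> \<and>
    reflect2 ` sol_trace U g x v \<mu> = sol_trace U g x v \<mu> \<and> 0 \<in> inside (sol_trace U g x v \<mu>)"
  using r sol_eq_global_solution [where g = g and \<mu> = \<mu> and U = U, OF g, of x v r]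
  unfolding symmetric_orbit_def periodic_sol_def sol_trace_def by simp

text \<open>Reduces the starting point \<open>(- \<rho>, 0)\<close> to \<open>(\<rho>, 0)\<close>. A set invariant under both reflections is
invariant under their composition \<open>z \<mapsto> - z\<close>, so the trace does not change.\<close>

lemma symmetric_orbit_negate:
  assumes r: "symmetric_orbit U g x v \<mu> r"
    and odd: "\<And>r. r \<in> U \<Longrightarrow> - r \<in> U \<and> g (- r) \<mu> = - g r \<mu>"
  shows "symmetric_orbit U g (- x) (- v) \<mu> (\<lambda>t. - r t)"
proof -
  obtain r' where r': "r 0 = x" "r' 0 = v" "\<And>t. r t \<in> U"
    "\<And>t. (r has_vector_derivative r' t) (at t)"
    "\<And>t. (r' has_vector_derivative g (r t) \<mu>) (at t)"
    using r unfolding symmetric_orbit_def solves_ivp_def by blast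
  have "solves_ivp U g (- x) (- v) \<mu> UNIV (\<lambda>t. - r t)"
    unfolding solves_ivp_def
    by (intro conjI exI [of _ "\<lambda>t. - r' t"])
       (use r' odd in \<open>auto simp: is_interval_def intro: has_vector_derivative_minus\<close>)
  moreover have "range (\<lambda>t. - r t) = range r"
  proof -
    have "reflect1 (reflect2 z) = - z" for z by (cases z) (simp add: reflect1_def reflect2_def)
    then have "range (\<lambda>t. - r t) = reflect1 ` reflect2 ` range r" by (simp add: image_image)
    then show ?thesis using r by (simp add: symmetric_orbit_def)
  qed
  ultimately show ?thesis using r by (simp add: symmetric_orbit_def)
qed

section \<open>Reflections and coordinates in phase space\<close>

lemma norm_polar: "0 \<le> c \<Longrightarrow> norm (c * cos x, c * sin x) = c" for c x :: real
proof -
  assume "0 \<le> c"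
  have "(c * cos x)\<^sup>2 + (c * sin x)\<^sup>2 = c\<^sup>2 * ((sin x)\<^sup>2 + (cos x)\<^sup>2)"
    by (simp only: power_mult_distrib algebra_simps)
  then show ?thesis using \<open>0 \<le> c\<close> by (simp add: norm_Pair)
qed

lemma reflect_simps [simp]:
  "reflect1 (x, y) = (- x, y)" "reflect2 (x, y) = (x, - y)"
  by (simp_all add: reflect1_def reflect2_def)

lemma norm_reflect [simp]: "norm (reflect1 z) = norm z" "norm (reflect2 z) = norm z"
  by (cases z; simp add: norm_Pair)+

lemma bounded_linear_reflect: "bounded_linear reflect1" "bounded_linear reflect2"
proof -
  have "bounded_linear (\<lambda>z :: plane. (- fst z, snd z))" "bounded_linear (\<lambda>z :: plane. (fst z, - snd z))"
    by (intro bounded_linear_Pair bounded_linear_minus bounded_linear_fst bounded_linear_snd)+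
  then show "bounded_linear reflect1" "bounded_linear reflect2"
    unfolding reflect1_def reflect2_def case_prod_unfold .
qed

lemma image_range_involution:
  assumes "\<And>t. h (R t) = R (\<phi> t)" "\<And>t. \<phi> (\<phi> t) = t"
  shows "h ` range R = range R"
  unfolding image_image assms(1) using assms(2) by (metis surjI range_composition image_image)

definition xc where "xc z = fst (fst z)" for z :: "plane \<times> plane"
definition yc where "yc z = snd (fst z)" for z :: "plane \<times> plane"
definition pc where "pc z = fst (snd z)" for z :: "plane \<times> plane"
definition qc where "qc z = snd (snd z)" for z :: "plane \<times> plane"
definition momentum where "momentum z = xc z * qc z - yc z * pc z"
lemmas components_def = xc_def yc_def pc_def qc_def

lemma continuous_components [continuous_intros]:
  "continuous_on S h \<Longrightarrow> continuous_on S (\<lambda>t. xc (h t))"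
  "continuous_on S h \<Longrightarrow> continuous_on S (\<lambda>t. yc (h t))"
  "continuous_on S h \<Longrightarrow> continuous_on S (\<lambda>t. pc (h t))"
  "continuous_on S h \<Longrightarrow> continuous_on S (\<lambda>t. qc (h t))"
  "continuous_on S h \<Longrightarrow> continuous_on S (\<lambda>t. momentum (h t))"
  unfolding momentum_def components_def by (intro continuous_intros; assumption)+

lemma norm_fst_eq: "norm (fst z) = sqrt ((xc z)\<^sup>2 + (yc z)\<^sup>2)" for z :: "plane \<times> plane"
  by (cases "fst z") (simp add: components_def norm_Pair)

section \<open>The flow of the cut-off equation\<close>

text \<open>The number \<open>\<eta>\<close> fixes two annuli around the circle: the force is cut off outside the one of
half-width \<open>2 \<eta>\<close> and left unchanged in the one of half-width \<open>\<eta>\<close>.\<close>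

locale perturbed_kepler =
  fixes \<rho> \<eta> a \<kappa> :: real and U :: "plane set" and g :: "plane \<Rightarrow> real \<Rightarrow> plane"
  assumes eta: "0 < \<eta>" "2 * \<eta> < \<rho>" and annulus: "{r. \<bar>norm r - \<rho>\<bar> \<le> 2 * \<eta>} \<subseteq> U"
    and openU: "open U" and a: "0 < a" and kappa: "0 < \<kappa>"
    and cont: "continuous_on (U \<times> {-a<..<a}) (\<lambda>(r, \<mu>). g r \<mu>)"
    and kepler: "\<And>r. r \<in> U \<Longrightarrow> g r 0 = - (\<kappa> / norm r ^ 3) *\<^sub>R r"
    and C1: "\<And>\<mu>. \<mu> \<in> {-a<..<a} \<Longrightarrow> C1_on U (\<lambda>r. g r \<mu>)"
    and g_reflect1: "\<And>r \<mu>. r \<in> U \<Longrightarrow> \<mu> \<in> {-a<..<a} \<Longrightarrow> g (reflect1 r) \<mu> = reflect1 (g r \<mu>)"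
    and g_reflect2: "\<And>r \<mu>. r \<in> U \<Longrightarrow> \<mu> \<in> {-a<..<a} \<Longrightarrow> g (reflect2 r) \<mu> = reflect2 (g r \<mu>)"
begin

definition A where "A = {r :: plane. \<bar>norm r - \<rho>\<bar> \<le> 2 * \<eta>}"

definition cutoff :: "plane \<Rightarrow> real" where
  "cutoff r = max 0 (min 1 (2 - \<bar>norm r - \<rho>\<bar> / \<eta>))"

definition f :: "real \<Rightarrow> plane \<Rightarrow> plane" where "f \<mu> r = cutoff r *\<^sub>R g r \<mu>"

lemma compact_A: "compact A"
proof -
  have "closed A" unfolding A_def by (intro closed_Collect_le continuous_intros)
  moreover have "A \<subseteq> cball 0 (\<rho> + 2 * \<eta>)" by (auto simp: A_def)
  ultimately show ?thesis using bounded_cball bounded_subset compact_eq_bounded_closed by blast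
qed

lemma A_subset: "A \<subseteq> U"
  using annulus by (simp add: A_def)

lemma cutoff_range: "0 \<le> cutoff r" "cutoff r \<le> 1"
  by (auto simp: cutoff_def)

lemma cutoff_one: "\<bar>norm r - \<rho>\<bar> \<le> \<eta> \<Longrightarrow> cutoff r = 1"
  using eta by (simp add: cutoff_def field_simps)

lemma cutoff_zero: "r \<notin> A \<Longrightarrow> cutoff r = 0"
  using eta by (simp add: cutoff_def A_def field_simps)

lemma cutoff_lipschitz: "\<bar>cutoff r - cutoff s\<bar> \<le> dist r s / \<eta>"
proof -
  have "\<bar>\<bar>norm r - \<rho>\<bar> - \<bar>norm s - \<rho>\<bar>\<bar> \<le> dist r s"
    unfolding dist_norm using norm_triangle_ineq3 [of r s] by linarith
  then have "\<bar>\<bar>norm r - \<rho>\<bar> / \<eta> - \<bar>norm s - \<rho>\<bar> / \<eta>\<bar> \<le> dist r s / \<eta>"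
    using eta by (simp add: diff_divide_distrib [symmetric] divide_right_mono)
  moreover have "\<bar>max 0 (min 1 (2 - u)) - max 0 (min 1 (2 - v))\<bar> \<le> \<bar>u - v\<bar>" for u v :: real
    by (auto simp: max_def min_def)
  ultimately show ?thesis unfolding cutoff_def by (meson order_trans)
qed

lemma f_eq_g: "\<bar>norm r - \<rho>\<bar> \<le> \<eta> \<Longrightarrow> f \<mu> r = g r \<mu>"
  by (simp add: f_def cutoff_one)

text \<open>As the cut-off function is Lipschitz and vanishes outside the compact set \<open>A\<close>, the product needs the
force to be bounded and Lipschitz on \<open>A\<close> only: if just one of two points lies in \<open>A\<close>, the value of the
cut-off function there is at most \<open>1 / \<eta>\<close> times their distance.\<close>

lemma f_lipschitz:
  assumes \<mu>: "\<mu> \<in> {-a<..<a}"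
  obtains L where "L-lipschitz_on UNIV (f \<mu>)"
proof -
  obtain L where L: "L-lipschitz_on A (\<lambda>r. g r \<mu>)"
    using C1_on_lipschitz_on_compact [where f = "\<lambda>r. g r \<mu>", OF C1 [OF \<mu>] openU compact_A A_subset] .
  have "bounded ((\<lambda>r. g r \<mu>) ` A)"
    by (intro compact_imp_bounded compact_continuous_image compact_A lipschitz_on_continuous_on [OF L])
  then obtain M where M: "\<And>r. r \<in> A \<Longrightarrow> norm (g r \<mu>) \<le> M" "0 < M"
    by (auto simp: bounded_pos)
  have L0: "0 \<le> L" using L by (rule lipschitz_on_nonneg)
  have one: "dist (f \<mu> r) (f \<mu> s) \<le> (M / \<eta> + L) * dist r s" if r: "r \<in> A" for r s
  proof -
    have "dist (f \<mu> r) (f \<mu> s) \<le> norm ((cutoff r - cutoff s) *\<^sub>R g r \<mu>) + norm (cutoff s *\<^sub>R (g r \<mu> - g s \<mu>))"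
      unfolding dist_norm f_def by (rule order_trans [OF _ norm_triangle_ineq]) (simp add: algebra_simps)
    also have "norm ((cutoff r - cutoff s) *\<^sub>R g r \<mu>) \<le> dist r s / \<eta> * M"
      unfolding norm_scaleR real_norm_def
      by (intro mult_mono cutoff_lipschitz M(1) r) (use eta in auto)
    also have "norm (cutoff s *\<^sub>R (g r \<mu> - g s \<mu>)) \<le> L * dist r s"
    proof (cases "s \<in> A")
      case True
      then have "norm (g r \<mu> - g s \<mu>) \<le> L * dist r s"
        using lipschitz_onD [OF L r] by (simp add: dist_norm)
      then show ?thesis
        unfolding norm_scaleR real_norm_def
        using mult_mono [of "\<bar>cutoff s\<bar>" 1 "norm (g r \<mu> - g s \<mu>)"] cutoff_range [of s] by simp
    next
      case False then show ?thesis using L0 by (simp add: cutoff_zero)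
    qed
    finally show ?thesis by (simp add: algebra_simps)
  qed
  have "(M / \<eta> + L)-lipschitz_on UNIV (f \<mu>)"
  proof (rule lipschitz_onI)
    show "0 \<le> M / \<eta> + L" using M(2) L0 eta by simp
    show "dist (f \<mu> r) (f \<mu> s) \<le> (M / \<eta> + L) * dist r s" for r s
    proof (cases "r \<in> A")
      case True then show ?thesis by (rule one)
    next
      case r: False
      show ?thesis
      proof (cases "s \<in> A")
        case True then show ?thesis using one [of s r] by (simp add: dist_commute)
      next
        case False then show ?thesis
          using r M(2) L0 eta by (simp add: f_def cutoff_zero)
      qed
    qed
  qed
  then show thesis by (rule that)
qed

lemma phase_lipschitz:
  assumes "\<mu> \<in> {-a<..<a}"
  obtains L where "L-lipschitz_on UNIV (phase_field (f \<mu>))"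
proof -
  obtain L where L: "L-lipschitz_on UNIV (f \<mu>)" using f_lipschitz [OF assms] .
  show thesis by (rule that, rule phase_field_lipschitz, rule lipschitz_on_subset [OF L subset_UNIV])
qed

definition flow :: "real \<Rightarrow> real \<Rightarrow> real \<Rightarrow> plane \<times> plane" where
  "flow s \<mu> = (SOME Y. Y 0 = ((\<rho>, 0), (0, s)) \<and>
     (\<forall>t. (Y has_vector_derivative phase_field (f \<mu>) (Y t)) (at t)))"

lemma
  assumes "\<mu> \<in> {-a<..<a}"
  shows flow_0: "flow s \<mu> 0 = ((\<rho>, 0), (0, s))"
    and flow_derivative: "(flow s \<mu> has_vector_derivative phase_field (f \<mu>) (flow s \<mu> t)) (at t)"
proof -
  have "\<exists>Y. Y 0 = ((\<rho>, 0), (0, s)) \<and> (\<forall>t. (Y has_vector_derivative phase_field (f \<mu>) (Y t)) (at t))"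
    using phase_lipschitz [OF assms] global_solution_exists [of _ "phase_field (f \<mu>)" "((\<rho>, 0), (0, s))"] by metis
  from someI_ex [OF this] show "flow s \<mu> 0 = ((\<rho>, 0), (0, s))"
    "(flow s \<mu> has_vector_derivative phase_field (f \<mu>) (flow s \<mu> t)) (at t)"
    unfolding flow_def by auto
qed

lemma flow_unique:
  assumes "\<mu> \<in> {-a<..<a}"
    and "\<And>t. (Y has_vector_derivative phase_field (f \<mu>) (Y t)) (at t)" "Y t0 = flow s \<mu> t0"
  shows "Y = flow s \<mu>"
  using phase_lipschitz [OF assms(1)] ode_unique_line [OF assms(2) flow_derivative [OF assms(1)] _ assms(3)]
  by metis

lemma f_parameter_close:
  assumes \<mu>1: "\<mu>1 \<in> {-a<..<a}" and "\<epsilon> > 0"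
  obtains d where "d > 0"
    "\<And>\<mu>. \<bar>\<mu> - \<mu>1\<bar> < d \<Longrightarrow> \<mu> \<in> {-a<..<a} \<and> (\<forall>r. norm (f \<mu> r - f \<mu>1 r) \<le> \<epsilon>)"
proof -
  obtain e where e: "e > 0" "cball \<mu>1 e \<subseteq> {-a<..<a}"
    using \<mu>1 by (metis open_contains_cball open_greaterThanLessThan)
  have "continuous_on (A \<times> cball \<mu>1 e) (\<lambda>(r, \<mu>). g r \<mu>)"
    using A_subset e(2) by (intro continuous_on_subset [OF cont]) auto
  then have "uniformly_continuous_on (A \<times> cball \<mu>1 e) (\<lambda>(r, \<mu>). g r \<mu>)"
    by (intro compact_uniformly_continuous compact_Times compact_A compact_cball)
  then obtain d where d: "d > 0"
    "\<And>z w. z \<in> A \<times> cball \<mu>1 e \<Longrightarrow> w \<in> A \<times> cball \<mu>1 e \<Longrightarrow> dist w z < d \<Longrightarrow>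
      dist ((\<lambda>(r, \<mu>). g r \<mu>) w) ((\<lambda>(r, \<mu>). g r \<mu>) z) < \<epsilon>"
    using \<open>\<epsilon> > 0\<close> unfolding uniformly_continuous_on_def by metis
  show thesis
  proof (rule that [of "min d e"])
    show "min d e > 0" using d e by simp
    fix \<mu> assume \<mu>: "\<bar>\<mu> - \<mu>1\<bar> < min d e"
    then have ball: "\<mu> \<in> cball \<mu>1 e" by (simp add: dist_real_def abs_minus_commute)
    have "norm (f \<mu> r - f \<mu>1 r) \<le> \<epsilon>" for r
    proof (cases "r \<in> A")
      case True
      have "dist (r, \<mu>) (r, \<mu>1) < d" using \<mu> by (simp add: dist_Pair_Pair dist_real_def)
      then have "norm (g r \<mu> - g r \<mu>1) < \<epsilon>"
        using d(2) [of "(r, \<mu>1)" "(r, \<mu>)"] True ball e by (simp add: dist_norm)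
      moreover have "norm (f \<mu> r - f \<mu>1 r) \<le> norm (g r \<mu> - g r \<mu>1)"
        using cutoff_range [of r] by (simp add: f_def scaleR_diff_right [symmetric] mult_left_le_one_le)
      ultimately show ?thesis by simp
    next
      case False then show ?thesis using \<open>\<epsilon> > 0\<close> by (simp add: f_def cutoff_zero)
    qed
    then show "\<mu> \<in> {-a<..<a} \<and> (\<forall>r. norm (f \<mu> r - f \<mu>1 r) \<le> \<epsilon>)" using ball e(2) by blast
  qed
qed

text \<open>The difference of two solutions is estimated with the Lipschitz constant at the fixed
parameter \<open>\<mu>1\<close>; the other parameter enters through the uniform distance of the two
fields only. This is why no Lipschitz bound uniform in \<open>\<mu>\<close> is needed.\<close>

lemma flow_close:
  assumes \<mu>1: "\<mu>1 \<in> {-a<..<a}" and "0 \<le> \<tau>" "0 < \<epsilon>"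
  obtains d where "d > 0" "\<And>s \<mu>. \<bar>s - s1\<bar> < d \<Longrightarrow> \<bar>\<mu> - \<mu>1\<bar> < d \<Longrightarrow>
      \<mu> \<in> {-a<..<a} \<and> (\<forall>t\<in>{0..\<tau>}. dist (flow s \<mu> t) (flow s1 \<mu>1 t) < \<epsilon>)"
proof -
  obtain L where L: "L-lipschitz_on UNIV (phase_field (f \<mu>1))" using phase_lipschitz [OF \<mu>1] .
  have L0: "0 \<le> L" using L by (rule lipschitz_on_nonneg)
  define E where "E = exp ((2 * L + 1) * \<tau>)"
  have E: "1 \<le> E" using L0 \<open>0 \<le> \<tau>\<close> by (simp add: E_def)
  \<comment> \<open>Chosen so that \<open>(e\<^sup>2 + e\<^sup>2) E < \<epsilon>\<^sup>2\<close>, where \<open>e\<close> bounds both the initial distance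
and the distance of the fields.\<close>
  define e where "e = \<epsilon> / (2 * E)"
  have e: "0 < e" using E \<open>0 < \<epsilon>\<close> by (simp add: e_def)
  obtain d where d: "d > 0"
    "\<And>\<mu>. \<bar>\<mu> - \<mu>1\<bar> < d \<Longrightarrow> \<mu> \<in> {-a<..<a} \<and> (\<forall>r. norm (f \<mu> r - f \<mu>1 r) \<le> e)"
    using f_parameter_close [OF \<mu>1 e] by metis
  show thesis
  proof (rule that [of "min d e"])
    show "min d e > 0" using d e by simp
    fix s \<mu> assume s: "\<bar>s - s1\<bar> < min d e" and "\<bar>\<mu> - \<mu>1\<bar> < min d e"
    then have \<mu>: "\<mu> \<in> {-a<..<a}" and fe: "\<And>r. norm (f \<mu> r - f \<mu>1 r) \<le> e" using d(2) by auto
    have "dist (flow s \<mu> t) (flow s1 \<mu>1 t) < \<epsilon>" if t: "t \<in> {0..\<tau>}" for t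
    proof -
      have "(norm (flow s \<mu> t - flow s1 \<mu>1 t))\<^sup>2
          \<le> ((norm (flow s \<mu> 0 - flow s1 \<mu>1 0))\<^sup>2 + e\<^sup>2) * exp ((2 * L + 1) * t)"
      proof (rule ode_comparison [OF _ _ L0 t])
        fix u :: real assume "u \<in> {0..\<tau>}"
        let ?Y = "flow s \<mu> u" and ?Z = "flow s1 \<mu>1 u"
        show "((\<lambda>t. flow s \<mu> t - flow s1 \<mu>1 t) has_vector_derivative
            phase_field (f \<mu>) ?Y - phase_field (f \<mu>1) ?Z) (at u)"
          by (intro has_vector_derivative_diff flow_derivative \<mu> \<mu>1)
        have "norm (phase_field (f \<mu>) ?Y - phase_field (f \<mu>1) ?Z)
            \<le> norm (phase_field (f \<mu>) ?Y - phase_field (f \<mu>1) ?Y)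
              + norm (phase_field (f \<mu>1) ?Y - phase_field (f \<mu>1) ?Z)"
          by (rule order_trans [OF _ norm_triangle_ineq]) simp
        also have "norm (phase_field (f \<mu>) ?Y - phase_field (f \<mu>1) ?Y) \<le> e"
          using fe [of "fst ?Y"] by (simp add: phase_field_def norm_Pair)
        also have "norm (phase_field (f \<mu>1) ?Y - phase_field (f \<mu>1) ?Z) \<le> L * norm (?Y - ?Z)"
          using lipschitz_onD [OF L, of ?Y ?Z] by (simp add: dist_norm)
        finally show "norm (phase_field (f \<mu>) ?Y - phase_field (f \<mu>1) ?Z) \<le> L * norm (?Y - ?Z) + e"
          by simp
      qed
      also have "norm (flow s \<mu> 0 - flow s1 \<mu>1 0) = \<bar>s - s1\<bar>"
        by (simp add: flow_0 [OF \<mu>] flow_0 [OF \<mu>1] norm_Pair)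
      also have "(\<bar>s - s1\<bar>\<^sup>2 + e\<^sup>2) * exp ((2 * L + 1) * t) \<le> (e\<^sup>2 + e\<^sup>2) * E"
      proof (rule mult_mono)
        show "\<bar>s - s1\<bar>\<^sup>2 + e\<^sup>2 \<le> e\<^sup>2 + e\<^sup>2" using s by (intro add_mono power_mono) auto
        show "exp ((2 * L + 1) * t) \<le> E" using t L0 by (auto simp: E_def intro!: mult_left_mono)
      qed auto
      also have "(e\<^sup>2 + e\<^sup>2) * E = \<epsilon>\<^sup>2 / (2 * E)"
        using E by (simp add: e_def field_simps power2_eq_square)
      also have "\<dots> < \<epsilon>\<^sup>2" using E \<open>0 < \<epsilon>\<close> by (simp add: field_simps)
      finally have "(norm (flow s \<mu> t - flow s1 \<mu>1 t))\<^sup>2 < \<epsilon>\<^sup>2" .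
      then show ?thesis unfolding dist_norm by (rule power_less_imp_less_base) (use \<open>0 < \<epsilon>\<close> in simp)
    qed
    then show "\<mu> \<in> {-a<..<a} \<and> (\<forall>t\<in>{0..\<tau>}. dist (flow s \<mu> t) (flow s1 \<mu>1 t) < \<epsilon>)"
      using \<mu> by blast
  qed
qed

lemma continuous_flow_time: "\<mu> \<in> {-a<..<a} \<Longrightarrow> continuous_on S (flow s \<mu>)"
  by (meson continuous_at_imp_continuous_on flow_derivative has_vector_derivative_continuous)

lemma continuous_flow:
  assumes "0 \<le> \<tau>"
  shows "continuous_on (({0..\<tau>} \<times> UNIV) \<times> {-a<..<a}) (\<lambda>((t, s), \<mu>). flow s \<mu> t)"
  unfolding continuous_on_iff
proof (intro ballI allI impI)
  fix z :: "(real \<times> real) \<times> real" and \<epsilon> :: real assume z: "z \<in> ({0..\<tau>} \<times> UNIV) \<times> {-a<..<a}" and "0 < \<epsilon>"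
  then obtain t1 s1 \<mu>1 :: real where z_eq: "z = ((t1, s1), \<mu>1)" and t1: "t1 \<in> {0..\<tau>}" and \<mu>1: "\<mu>1 \<in> {-a<..<a}"
    by (cases z) auto
  obtain d where d: "d > 0" "\<And>s \<mu>. \<bar>s - s1\<bar> < d \<Longrightarrow> \<bar>\<mu> - \<mu>1\<bar> < d \<Longrightarrow>
      \<mu> \<in> {-a<..<a} \<and> (\<forall>t\<in>{0..\<tau>}. dist (flow s \<mu> t) (flow s1 \<mu>1 t) < \<epsilon> / 2)"
    using flow_close [OF \<mu>1 assms half_gt_zero [OF \<open>0 < \<epsilon>\<close>]] by metis
  obtain e where e: "e > 0" "\<And>t. \<bar>t - t1\<bar> < e \<Longrightarrow> dist (flow s1 \<mu>1 t) (flow s1 \<mu>1 t1) < \<epsilon> / 2"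
    using continuous_flow_time [OF \<mu>1, of UNIV s1] half_gt_zero [OF \<open>0 < \<epsilon>\<close>]
    unfolding continuous_on_iff dist_real_def by (metis UNIV_I)
  show "\<exists>d>0. \<forall>w\<in>({0..\<tau>} \<times> UNIV) \<times> {-a<..<a}. dist w z < d \<longrightarrow>
      dist (case w of (x, xa) \<Rightarrow> (case x of (t, s) \<Rightarrow> \<lambda>\<mu>. flow s \<mu> t) xa)
        (case z of (x, xa) \<Rightarrow> (case x of (t, s) \<Rightarrow> \<lambda>\<mu>. flow s \<mu> t) xa) < \<epsilon>"
  proof (intro exI [of _ "min d e"] conjI ballI impI)
    show "0 < min d e" using d e by simp
    fix w :: "(real \<times> real) \<times> real" assume w: "w \<in> ({0..\<tau>} \<times> UNIV) \<times> {-a<..<a}" "dist w z < min d e"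
    then obtain t s \<mu> :: real where w_eq: "w = ((t, s), \<mu>)" and t: "t \<in> {0..\<tau>}" by (cases w) auto
    have "dist (t, s) (t1, s1) < min d e" "dist \<mu> \<mu>1 < min d e"
      using w(2) dist_fst_le [of w z] dist_snd_le [of w z] by (simp_all add: w_eq z_eq)
    moreover have "dist t t1 \<le> dist (t, s) (t1, s1)" "dist s s1 \<le> dist (t, s) (t1, s1)"
      using dist_fst_le [of "(t, s)" "(t1, s1)"] dist_snd_le [of "(t, s)" "(t1, s1)"] by simp_all
    ultimately have "\<bar>t - t1\<bar> < e" "\<bar>s - s1\<bar> < d" "\<bar>\<mu> - \<mu>1\<bar> < d" by (simp_all add: dist_real_def)
    then have "dist (flow s \<mu> t) (flow s1 \<mu>1 t) < \<epsilon> / 2" "dist (flow s1 \<mu>1 t) (flow s1 \<mu>1 t1) < \<epsilon> / 2"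
      using d(2) e(2) t by auto
    then have "dist (flow s \<mu> t) (flow s1 \<mu>1 t1) < \<epsilon>"
      using dist_triangle [of "flow s \<mu> t" "flow s1 \<mu>1 t1" "flow s1 \<mu>1 t"] by linarith
    then show "dist (case w of (x, xa) \<Rightarrow> (case x of (t, s) \<Rightarrow> \<lambda>\<mu>. flow s \<mu> t) xa)
        (case z of (x, xa) \<Rightarrow> (case x of (t, s) \<Rightarrow> \<lambda>\<mu>. flow s \<mu> t) xa) < \<epsilon>"
      by (simp add: w_eq z_eq)
  qed
qed

text \<open>Every strict inequality that holds along a compact piece of an orbit persists for nearby
parameters.\<close>

lemma flow_stays_in_open:
  assumes \<mu>1: "\<mu>1 \<in> {-a<..<a}" and "0 \<le> \<alpha>" "open W" "\<And>t. t \<in> {\<alpha>..\<beta>} \<Longrightarrow> flow s1 \<mu>1 t \<in> W"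
  obtains d where "d > 0" "\<And>s \<mu> t. \<bar>s - s1\<bar> < d \<Longrightarrow> \<bar>\<mu> - \<mu>1\<bar> < d \<Longrightarrow> t \<in> {\<alpha>..\<beta>} \<Longrightarrow> flow s \<mu> t \<in> W"
proof -
  have "compact (flow s1 \<mu>1 ` {\<alpha>..\<beta>})"
    by (intro compact_continuous_image continuous_flow_time \<mu>1 compact_Icc)
  moreover have "flow s1 \<mu>1 ` {\<alpha>..\<beta>} \<subseteq> W" using assms(4) by blast
  ultimately obtain \<epsilon> where \<epsilon>: "\<epsilon> > 0" "(\<Union>z\<in>flow s1 \<mu>1 ` {\<alpha>..\<beta>}. ball z \<epsilon>) \<subseteq> W"
    using compact_subset_open_imp_ball_epsilon_subset \<open>open W\<close> by metis
  obtain d where d: "d > 0" "\<And>s \<mu>. \<bar>s - s1\<bar> < d \<Longrightarrow> \<bar>\<mu> - \<mu>1\<bar> < d \<Longrightarrow>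
      \<mu> \<in> {-a<..<a} \<and> (\<forall>t\<in>{0..max 0 \<beta>}. dist (flow s \<mu> t) (flow s1 \<mu>1 t) < \<epsilon>)"
    using flow_close [OF \<mu>1 _ \<epsilon>(1), of "max 0 \<beta>"] by (metis max.cobounded1)
  show thesis
  proof (rule that [OF d(1)])
    fix s \<mu> t assume *: "\<bar>s - s1\<bar> < d" "\<bar>\<mu> - \<mu>1\<bar> < d" "t \<in> {\<alpha>..\<beta>}"
    then have "t \<in> {0..max 0 \<beta>}" using \<open>0 \<le> \<alpha>\<close> by auto
    then have "dist (flow s1 \<mu>1 t) (flow s \<mu> t) < \<epsilon>" using d(2) [OF *(1,2)] by (simp add: dist_commute)
    then show "flow s \<mu> t \<in> W" using \<epsilon>(2) *(3) by (meson UN_I imageI mem_ball subsetD)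
  qed
qed

section \<open>A quarter orbit generates a symmetric periodic orbit\<close>

lemma f_reflect:
  assumes "\<mu> \<in> {-a<..<a}"
  shows "f \<mu> (reflect1 r) = reflect1 (f \<mu> r)" "f \<mu> (reflect2 r) = reflect2 (f \<mu> r)"
proof -
  have c: "cutoff (reflect1 r) = cutoff r" "cutoff (reflect2 r) = cutoff r"
    by (simp_all add: cutoff_def)
  have s: "reflect1 (c *\<^sub>R z) = c *\<^sub>R reflect1 z" "reflect2 (c *\<^sub>R z) = c *\<^sub>R reflect2 z" for c z
    by (cases z; simp)+
  have "r \<in> U" if "cutoff r \<noteq> 0" using that cutoff_zero A_subset by blast
  then show "f \<mu> (reflect1 r) = reflect1 (f \<mu> r)" "f \<mu> (reflect2 r) = reflect2 (f \<mu> r)"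
    using g_reflect1 [OF _ assms] g_reflect2 [OF _ assms]
    by (cases "cutoff r = 0"; simp add: f_def c s zero_prod_def)+
qed

text \<open>A solution that at time \<open>c / 2\<close> is perpendicular to the axis of a reflection \<open>\<sigma>\<close> is reversible about
that time: reflecting and reversing it gives a solution with the same state at time \<open>c / 2\<close>.\<close>

lemma flow_reversed:
  assumes \<mu>: "\<mu> \<in> {-a<..<a}" and \<sigma>: "bounded_linear \<sigma>" "\<And>r. f \<mu> (\<sigma> r) = \<sigma> (f \<mu> r)"
    and turn: "\<sigma> (fst (flow s \<mu> (c / 2))) = fst (flow s \<mu> (c / 2))"
      "\<sigma> (snd (flow s \<mu> (c / 2))) = - snd (flow s \<mu> (c / 2))"
  shows "flow s \<mu> (c - t) = (\<sigma> (fst (flow s \<mu> t)), - \<sigma> (snd (flow s \<mu> t)))"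
proof -
  define Z where "Z t = (\<sigma> (fst (flow s \<mu> (c - t))), - \<sigma> (snd (flow s \<mu> (c - t))))" for t
  have "Z = flow s \<mu>"
  proof (rule flow_unique [OF \<mu>])
    show "Z (c / 2) = flow s \<mu> (c / 2)"
      using turn by (simp add: Z_def prod_eq_iff)
    fix t
    let ?Y = "flow s \<mu> (c - t)"
    have "((\<lambda>t. flow s \<mu> (c - t)) has_vector_derivative - phase_field (f \<mu>) ?Y) (at t)"
      by (intro has_vector_derivative_reverse flow_derivative \<mu>)
    from has_vector_derivative_fst [OF this] has_vector_derivative_snd [OF this]
    have "((\<lambda>t. \<sigma> (fst (flow s \<mu> (c - t)))) has_vector_derivative \<sigma> (- snd ?Y)) (at t)"
      "((\<lambda>t. \<sigma> (snd (flow s \<mu> (c - t)))) has_vector_derivative \<sigma> (- f \<mu> (fst ?Y))) (at t)"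
      by (auto intro!: bounded_linear.has_vector_derivative [OF \<sigma>(1)] simp: phase_field_def)
    then have "(Z has_vector_derivative (\<sigma> (- snd ?Y), - \<sigma> (- f \<mu> (fst ?Y)))) (at t)"
      unfolding Z_def by (intro has_vector_derivative_Pair has_vector_derivative_minus)
    also have "(\<sigma> (- snd ?Y), - \<sigma> (- f \<mu> (fst ?Y))) = phase_field (f \<mu>) (Z t)"
      by (simp add: Z_def phase_field_def \<sigma>(2) linear_neg bounded_linear.linear [OF \<sigma>(1)])
    finally show "(Z has_vector_derivative phase_field (f \<mu>) (Z t)) (at t)" .
  qed
  then have "flow s \<mu> (c - t) = Z (c - t)" by simp
  then show ?thesis by (simp add: Z_def)
qed

lemma flow_components:
  assumes "\<mu> \<in> {-a<..<a}"
  shows "((\<lambda>t. xc (flow s \<mu> t)) has_real_derivative pc (flow s \<mu> t)) (at t)"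
    and "((\<lambda>t. yc (flow s \<mu> t)) has_real_derivative qc (flow s \<mu> t)) (at t)"
    and "((\<lambda>t. pc (flow s \<mu> t)) has_real_derivative fst (f \<mu> (fst (flow s \<mu> t)))) (at t)"
    and "((\<lambda>t. qc (flow s \<mu> t)) has_real_derivative snd (f \<mu> (fst (flow s \<mu> t)))) (at t)"
  using has_vector_derivative_fst [OF has_vector_derivative_fst [OF flow_derivative [OF assms, of s t]]]
    has_vector_derivative_snd [OF has_vector_derivative_fst [OF flow_derivative [OF assms, of s t]]]
    has_vector_derivative_fst [OF has_vector_derivative_snd [OF flow_derivative [OF assms, of s t]]]
    has_vector_derivative_snd [OF has_vector_derivative_snd [OF flow_derivative [OF assms, of s t]]]
  unfolding has_real_derivative_iff_has_vector_derivative components_def phase_field_def by simp_all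

text \<open>Reversibility about the times \<open>0\<close> and \<open>T\<close> gives \<open>r (t + 2 T) = - r t\<close> and carries the estimates
on \<open>[0, T]\<close> over to all times, so the solution of the cut-off equation solves the original one.
The same symmetries of the angular velocity show that the polar angle
grows by \<open>2 \<pi>\<close> in the time \<open>4 T\<close>, once it is known to be \<open>\<pi> / 2\<close> at time \<open>T\<close>.\<close>

theorem quarter_orbit_symmetric:
  assumes \<mu>: "\<mu> \<in> {-a<..<a}" and T: "0 < T"
    and inside: "\<And>t. t \<in> {0..T} \<Longrightarrow> \<bar>norm (fst (flow s \<mu> t)) - \<rho>\<bar> \<le> \<eta>"
    and momentum: "\<And>t. t \<in> {0..T} \<Longrightarrow> momentum (flow s \<mu> t) > 0"
    and right: "\<And>t. t \<in> {0..<T} \<Longrightarrow> xc (flow s \<mu> t) > 0"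
    and hit: "xc (flow s \<mu> T) = 0" "qc (flow s \<mu> T) = 0"
  shows "symmetric_orbit U g (\<rho>, 0) (0, s) \<mu> (\<lambda>t. fst (flow s \<mu> t))"
proof -
  let ?Y = "flow s \<mu>"
  define R where "R t = fst (?Y t)" for t
  have rewind: "?Y (- t) = (reflect2 (fst (?Y t)), - reflect2 (snd (?Y t)))" for t
    using flow_reversed [OF \<mu> bounded_linear_reflect(2) f_reflect(2) [OF \<mu>], of s 0 t]
    by (simp add: flow_0 [OF \<mu>])
  have mirror: "?Y (2 * T - t) = (reflect1 (fst (?Y t)), - reflect1 (snd (?Y t)))" for t
  proof (rule flow_reversed [OF \<mu> bounded_linear_reflect(1) f_reflect(1) [OF \<mu>]])
    show "reflect1 (fst (?Y (2 * T / 2))) = fst (?Y (2 * T / 2))"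
      "reflect1 (snd (?Y (2 * T / 2))) = - snd (?Y (2 * T / 2))"
      using hit by (simp_all add: reflect1_def components_def case_prod_unfold prod_eq_iff)
  qed
  have shift: "?Y (t + 2 * T) = - ?Y t" for t
    using mirror [of "- t"] rewind [of t]
    by (cases "?Y t") (auto simp: add.commute reflect1_def reflect2_def case_prod_unfold prod_eq_iff)
  have period: "?Y (t + 4 * T) = ?Y t" for t
    using shift [of "t + 2 * T"] shift [of t] by (simp add: algebra_simps)
  define good where "good z \<longleftrightarrow> \<bar>norm (fst z) - \<rho>\<bar> \<le> \<eta> \<and> momentum z > 0" for z :: "plane \<times> plane"
  have good: "good (?Y t)" for t
  proof -
    have good_shift: "good (?Y (t + 2 * T)) = good (?Y t)" for t
      unfolding shift by (simp add: good_def momentum_def components_def)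
    obtain u where u: "u \<in> {0..2 * T}" "good (?Y u) = good (?Y t)"
      using periodic_value_in_period [of "\<lambda>t. good (?Y t)" "2 * T" t] good_shift T by auto
    show ?thesis
    proof (cases "u \<le> T")
      case True
      then have "good (?Y u)" using u inside momentum by (simp add: good_def)
      then show ?thesis using u by simp
    next
      case False
      then have "good (?Y (2 * T - u))" using u inside momentum by (simp add: good_def)
      then have "good (?Y u)"
        unfolding mirror by (simp add: good_def norm_fst_eq norm_Pair momentum_def components_def reflect1_def case_prod_unfold)
      then show ?thesis using u by simp
    qed
  qed
  have U: "R t \<in> U" for t
    using good [of t] annulus eta unfolding good_def R_def by auto
  have field: "f \<mu> (fst (?Y t)) = g (fst (?Y t)) \<mu>" for t
    using good [of t] by (intro f_eq_g) (simp add: good_def)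
  have ivp: "solves_ivp U g (\<rho>, 0) (0, s) \<mu> UNIV (\<lambda>t. fst (?Y t))"
  proof (rule phase_solves_ivp)
    show "(?Y has_vector_derivative phase_field (\<lambda>r. g r \<mu>) (?Y t)) (at t)" for t
      using flow_derivative [OF \<mu>, of s t] field by (simp add: phase_field_def)
  qed (use U in \<open>auto simp: flow_0 [OF \<mu>] R_def\<close>)

  have pos: "0 < (xc (?Y t))\<^sup>2 + (yc (?Y t))\<^sup>2" for t
  proof -
    have "0 < norm (fst (?Y t))" using good [of t] eta by (auto simp: good_def)
    then show ?thesis unfolding norm_fst_eq by simp
  qed
  have contY: "continuous_on S ?Y" for S by (rule continuous_flow_time [OF \<mu>])
  obtain \<Theta> where \<Theta>0: "\<Theta> 0 = 0"
    and \<Theta>: "\<And>t. (\<Theta> has_real_derivative momentum (?Y t) / ((xc (?Y t))\<^sup>2 + (yc (?Y t))\<^sup>2)) (at t)"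
    and x\<Theta>: "\<And>t. xc (?Y t) = sqrt ((xc (?Y t))\<^sup>2 + (yc (?Y t))\<^sup>2) * cos (\<Theta> t)"
    and y\<Theta>: "\<And>t. yc (?Y t) = sqrt ((xc (?Y t))\<^sup>2 + (yc (?Y t))\<^sup>2) * sin (\<Theta> t)"
  proof (rule polar_angle [OF flow_components(1,2) [OF \<mu>]])
    show "continuous_on UNIV (\<lambda>t. pc (?Y t))" "continuous_on UNIV (\<lambda>t. qc (?Y t))"
      by (intro continuous_intros contY)+
    show "0 < xc (?Y 0)" "yc (?Y 0) = 0"
      using eta by (simp_all add: flow_0 [OF \<mu>] components_def)
  qed (use pos in \<open>auto simp: momentum_def\<close>)
  have mono: "strict_mono \<Theta>"
  proof (rule strict_monoI)
    fix t u :: real assume "t < u"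
    then show "\<Theta> t < \<Theta> u"
      by (rule DERIV_pos_imp_increasing)
         (use \<Theta> good pos in \<open>meson divide_pos_pos good_def\<close>)
  qed
  have \<Theta>cont: "continuous_on S \<Theta>" for S
    using \<Theta> by (meson DERIV_isCont continuous_at_imp_continuous_on)
  have cos_right: "cos (\<Theta> t) > 0" if "t \<in> {0..<T}" for t
    using right [OF that] x\<Theta> [of t] pos [of t] by (metis real_sqrt_gt_0_iff zero_less_mult_pos)
  have cosT: "cos (\<Theta> T) = 0"
    using hit(1) x\<Theta> [of T] pos [of T] by (metis less_irrefl mult_eq_0_iff real_sqrt_gt_0_iff)
  \<comment> \<open>The cosine of the angle is positive before \<open>T\<close> and vanishes at \<open>T\<close>.\<close>
  have \<Theta>T: "\<Theta> T = pi / 2"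
  proof (rule antisym)
    show "\<Theta> T \<le> pi / 2"
    proof (rule ccontr)
      assume "\<not> \<Theta> T \<le> pi / 2"
      then obtain t where t: "0 \<le> t" "t \<le> T" "\<Theta> t = pi / 2"
        using IVT' [of \<Theta> 0 "pi / 2" T] T \<Theta>0 \<Theta>cont by auto
      moreover have "t \<noteq> T" using t \<open>\<not> \<Theta> T \<le> pi / 2\<close> by auto
      moreover have "cos (\<Theta> t) = 0" unfolding t(3) by simp
      ultimately show False using cos_right [of t] by simp
    qed
    have "0 < \<Theta> T" using strict_monoD [OF mono T] \<Theta>0 by simp
    then show "pi / 2 \<le> \<Theta> T" using cosT cos_gt_zero [of "\<Theta> T"] by fastforce
  qed
  define \<omega> where "\<omega> t = momentum (?Y t) / ((xc (?Y t))\<^sup>2 + (yc (?Y t))\<^sup>2)" for t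
  have d\<Theta>: "(\<Theta> has_real_derivative \<omega> t) (at t)" for t unfolding \<omega>_def by (rule \<Theta>)
  have \<omega>_sym: "\<omega> (2 * T - t) = \<omega> t" "\<omega> (t + 2 * T) = \<omega> t" for t
    unfolding \<omega>_def mirror shift
    by (simp_all add: momentum_def components_def reflect1_def case_prod_unfold)
  have const1: "((\<lambda>t. \<Theta> (2 * T - t) + \<Theta> t) has_real_derivative 0) (at t)" for t
  proof -
    have "((\<lambda>t. 2 * T - t) has_real_derivative - 1) (at t)"
      by (auto intro!: derivative_eq_intros)
    then have "((\<lambda>t. \<Theta> (2 * T - t)) has_real_derivative \<omega> (2 * T - t) * - 1) (at t)"
      by (rule DERIV_chain2 [OF d\<Theta>])
    from DERIV_add [OF this d\<Theta>] show ?thesis by (simp add: \<omega>_sym)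
  qed
  have "\<Theta> (2 * T - 0) + \<Theta> 0 = \<Theta> (2 * T - T) + \<Theta> T"
    by (rule DERIV_isconst_all [where f = "\<lambda>t. \<Theta> (2 * T - t) + \<Theta> t"]) (use const1 in blast)
  then have \<Theta>2T: "\<Theta> (2 * T) = pi" using \<Theta>T \<Theta>0 by simp
  have const2: "((\<lambda>t. \<Theta> (t + 2 * T) - \<Theta> t) has_real_derivative 0) (at t)" for t
  proof -
    have "((\<lambda>t. t + 2 * T) has_real_derivative 1) (at t)"
      by (auto intro!: derivative_eq_intros)
    then have "((\<lambda>t. \<Theta> (t + 2 * T)) has_real_derivative \<omega> (t + 2 * T) * 1) (at t)"
      by (rule DERIV_chain2 [OF d\<Theta>])
    from DERIV_diff [OF this d\<Theta>] show ?thesis by (simp add: \<omega>_sym)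
  qed
  have "\<Theta> (2 * T + 2 * T) - \<Theta> (2 * T) = \<Theta> (0 + 2 * T) - \<Theta> 0"
    by (rule DERIV_isconst_all [where f = "\<lambda>t. \<Theta> (t + 2 * T) - \<Theta> t"]) (use const2 in blast)
  then have \<Theta>4T: "\<Theta> (4 * T) = 2 * pi" using \<Theta>2T \<Theta>0 by simp
  have range_eq: "range R = R ` {0..4 * T}"
  proof
    show "range R \<subseteq> R ` {0..4 * T}"
    proof
      fix z assume "z \<in> range R"
      then obtain t where "z = R t" by blast
      then show "z \<in> R ` {0..4 * T}"
        using periodic_value_in_period [of R "4 * T" t] period T by (metis R_def image_eqI mult_pos_pos zero_less_numeral)
    qed
  qed auto
  have "continuous_on UNIV R" unfolding R_def by (intro continuous_intros contY)
  moreover have "R t = norm (R t) *\<^sub>R (cos (\<Theta> t), sin (\<Theta> t))" for t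
    using x\<Theta> [of t] y\<Theta> [of t] unfolding R_def norm_fst_eq by (simp add: components_def prod_eq_iff)
  moreover have "R t \<noteq> 0" for t using U annulus good [of t] eta by (auto simp: good_def R_def)
  moreover have "R (4 * T) = R 0" using period [of 0] by (simp add: R_def)
  ultimately have "simple_closed_curve (range R)" "0 \<in> inside (range R)"
    unfolding range_eq
    using polar_closed_curve [of R \<Theta> "4 * T"] \<Theta>cont mono T \<Theta>0 \<Theta>4T by auto
  moreover have "reflect1 ` range R = range R" "reflect2 ` range R = range R"
  proof -
    show "reflect1 ` range R = range R"
      by (rule image_range_involution [of _ _ "\<lambda>t. 2 * T - t"]) (simp_all add: R_def mirror)
    show "reflect2 ` range R = range R"
      by (rule image_range_involution [of _ _ uminus]) (simp_all add: R_def rewind)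
  qed
  moreover have "\<exists>P>0. \<forall>t. R (t + P) = R t"
    using period T by (intro exI [of _ "4 * T"]) (simp add: R_def)
  ultimately show ?thesis using ivp unfolding symmetric_orbit_def R_def by simp
qed

section \<open>The unperturbed Kepler problem\<close>

text \<open>The first component of the Laplace-Runge-Lenz vector, multiplied by the distance to the
origin in order to be continuous on all of phase space.\<close>

definition runge where "runge z = norm (fst z) * (qc z * momentum z) - \<kappa> * xc z"

text \<open>For the Kepler force, \<open>q \<ell> - \<kappa> x / \<parallel>r\<parallel>\<close> is constant in time, where \<open>q\<close> is the vertical velocity and
\<open>\<ell>\<close> the angular momentum; at the starting point it equals \<open>\<rho> s\<^sup>2 - \<kappa>\<close>.\<close>

lemma runge_conserved:
  assumes inside: "\<And>u. u \<in> {0..t} \<Longrightarrow> \<bar>norm (fst (flow s 0 u)) - \<rho>\<bar> \<le> \<eta>" and "0 \<le> t"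
  shows "runge (flow s 0 t) = norm (fst (flow s 0 t)) * (\<rho> * s\<^sup>2 - \<kappa>)"
proof -
  have \<mu>: "0 \<in> {-a<..<a}" using a by simp
  let ?Y = "flow s 0"
  define n where "n u = sqrt ((xc (?Y u))\<^sup>2 + (yc (?Y u))\<^sup>2)" for u
  define h where "h u = qc (?Y u) * momentum (?Y u) - \<kappa> * (xc (?Y u) * inverse (n u))" for u
  have "(h has_real_derivative 0) (at u)" if u: "u \<in> {0..t}" for u
  proof -
    define x y p q where "x = xc (?Y u)" and "y = yc (?Y u)" and "p = pc (?Y u)" and "q = qc (?Y u)"
    have n_eq: "n u = norm (fst (?Y u))" by (simp add: n_def norm_fst_eq)
    have n: "n u > 0" using inside [OF u] eta by (auto simp: n_eq)
    have nn: "(n u)\<^sup>2 = x\<^sup>2 + y\<^sup>2" by (simp add: n_def x_def y_def)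
    have "fst (?Y u) \<in> U" using inside [OF u] annulus eta by auto
    then have field: "f 0 (fst (?Y u)) = (- \<kappa> / n u ^ 3 * x, - \<kappa> / n u ^ 3 * y)"
      using kepler f_eq_g [OF inside [OF u], of 0]
      by (simp add: n_eq x_def y_def components_def prod_eq_iff)
    note d = flow_components [OF \<mu>, of s u, unfolded field fst_conv snd_conv]
    have dn: "(n has_real_derivative (x * p + y * q) / n u) (at u)"
    proof -
      have "((\<lambda>u. (xc (?Y u))\<^sup>2 + (yc (?Y u))\<^sup>2) has_real_derivative 2 * x * p + 2 * y * q) (at u)"
        by (auto intro!: derivative_eq_intros d(1,2) simp: x_def y_def p_def q_def)
      moreover have "0 < (xc (?Y u))\<^sup>2 + (yc (?Y u))\<^sup>2" using n by (simp add: n_def)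
      ultimately have "(n has_real_derivative inverse (n u) / 2 * (2 * x * p + 2 * y * q)) (at u)"
        unfolding n_def by (rule DERIV_chain2 [OF DERIV_real_sqrt, rotated])
      moreover have "inverse (n u) / 2 * (2 * x * p + 2 * y * q) = (x * p + y * q) / n u"
        using n by (simp add: field_simps)
      ultimately show ?thesis by (simp only:)
    qed
    have dm: "((\<lambda>u. momentum (?Y u)) has_real_derivative 0) (at u)"
      unfolding momentum_def
      by (rule DERIV_cong [OF DERIV_diff [OF DERIV_mult [OF d(1,4)] DERIV_mult [OF d(2,3)]]])
         (simp add: x_def y_def)
    have mom: "momentum (?Y u) = x * q - y * p"
      by (simp add: momentum_def x_def y_def p_def q_def)
    have "(h has_real_derivative - \<kappa> / n u ^ 3 * y * momentum (?Y u) + 0 * qc (?Y u)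
        - \<kappa> * (pc (?Y u) * inverse (n u)
          + - ((x * p + y * q) / n u * inverse (n u ^ Suc (Suc 0))) * xc (?Y u))) (at u)"
      unfolding h_def
      by (rule DERIV_diff [OF DERIV_mult [OF d(4) dm]
            DERIV_cmult [OF DERIV_mult [OF d(1) DERIV_inverse_fun [OF dn less_imp_neq [OF n, symmetric]]]]])
    also have "- \<kappa> / n u ^ 3 * y * momentum (?Y u) + 0 * qc (?Y u)
        - \<kappa> * (pc (?Y u) * inverse (n u)
          + - ((x * p + y * q) / n u * inverse (n u ^ Suc (Suc 0))) * xc (?Y u))
        = - \<kappa> / n u ^ 3 * (y * (x * q - y * p) + p * (n u)\<^sup>2 - x * (x * p + y * q))"
      unfolding mom x_def [symmetric] p_def [symmetric]
      using n by (simp add: divide_simps power2_eq_square power3_eq_cube) (simp add: algebra_simps)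
    also have "\<dots> = 0" unfolding nn by (simp add: algebra_simps power2_eq_square)
    finally show ?thesis .
  qed
  then have "\<exists>c. \<forall>u\<in>{0..t}. h u = c"
    by (intro has_field_derivative_zero_constant) (auto intro: has_field_derivative_at_within)
  then have "h t = h 0" using \<open>0 \<le> t\<close> by auto
  moreover have "h 0 = \<rho> * s\<^sup>2 - \<kappa>"
    using eta by (simp add: h_def n_def flow_0 [OF \<mu>] momentum_def components_def power2_eq_square)
  ultimately have ht: "h t = \<rho> * s\<^sup>2 - \<kappa>" by simp
  have nt: "n t = norm (fst (?Y t))" by (simp add: n_def norm_fst_eq)
  have "n t > 0" using inside [of t] \<open>0 \<le> t\<close> eta unfolding nt by auto
  then have "runge (?Y t) = n t * h t"
    by (simp add: runge_def h_def nt [symmetric] algebra_simps)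
  then show ?thesis by (simp add: ht nt)
qed

definition circular_speed where "circular_speed = sqrt (\<kappa> / \<rho>)"
definition angular_speed where "angular_speed = circular_speed / \<rho>"

lemma speeds_pos: "0 < circular_speed" "0 < angular_speed"
  using kappa eta by (auto simp: circular_speed_def angular_speed_def)

lemma circular_speed_squared: "\<rho> * circular_speed\<^sup>2 = \<kappa>"
  using kappa eta by (simp add: circular_speed_def)

lemma flow_circular:
  "flow circular_speed 0 t =
    ((\<rho> * cos (angular_speed * t), \<rho> * sin (angular_speed * t)),
     (- circular_speed * sin (angular_speed * t), circular_speed * cos (angular_speed * t)))"
proof -
  have \<mu>: "0 \<in> {-a<..<a}" using a by simp
  define \<omega> s where "\<omega> = angular_speed" and "s = circular_speed"
  have \<rho>: "\<rho> > 0" using eta by simp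
  define Y where "Y t = ((\<rho> * cos (\<omega> * t), \<rho> * sin (\<omega> * t)), (- s * sin (\<omega> * t), s * cos (\<omega> * t)))" for t
  have "Y = flow s 0"
  proof (rule flow_unique [OF \<mu>])
    show "Y 0 = flow s 0 0" by (simp add: Y_def flow_0 [OF \<mu>])
    fix t
    have norm: "norm (fst (Y t)) = \<rho>" using \<rho> by (simp add: Y_def norm_polar)
    have "fst (Y t) \<in> U" using norm annulus eta by auto
    then have field: "f 0 (fst (Y t)) = - (\<kappa> / \<rho> ^ 3) *\<^sub>R fst (Y t)"
      using kepler [of "fst (Y t)"] f_eq_g [of "fst (Y t)" 0] norm eta by simp
    have accel: "\<kappa> * (\<rho> * c) / \<rho> ^ 3 = \<omega> * (s * c)" for c
      using circular_speed_squared [symmetric] \<rho>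
      by (simp add: \<omega>_def s_def angular_speed_def field_simps power2_eq_square power3_eq_cube)
    have speed: "\<rho> * \<omega> = s" using \<rho> by (simp add: \<omega>_def s_def angular_speed_def)
    have "(Y has_vector_derivative
        ((- \<rho> * \<omega> * sin (\<omega> * t), \<rho> * \<omega> * cos (\<omega> * t)),
         (- s * \<omega> * cos (\<omega> * t), - s * \<omega> * sin (\<omega> * t)))) (at t)"
      unfolding Y_def
      by (intro has_vector_derivative_Pair; unfold has_real_derivative_iff_has_vector_derivative [symmetric])
         (auto intro!: derivative_eq_intros)
    also have "((- \<rho> * \<omega> * sin (\<omega> * t), \<rho> * \<omega> * cos (\<omega> * t)),
         (- s * \<omega> * cos (\<omega> * t), - s * \<omega> * sin (\<omega> * t))) = phase_field (f 0) (Y t)"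
      unfolding phase_field_def field by (simp add: Y_def speed accel)
    finally show "(Y has_vector_derivative phase_field (f 0) (Y t)) (at t)" .
  qed
  then have "flow s 0 t = Y t" by simp
  then show ?thesis unfolding Y_def \<omega>_def s_def .
qed

section \<open>Continuation of the circular orbit\<close>

text \<open>The unknowns are \<open>(u, s)\<close> with \<open>u\<close> between an eighth and three eighths of the period of the circular
orbit, and \<open>F\<close> is the map whose zeros are the quarter orbits. Its first component is the
negated abscissa because \<open>continuum_of_zeros\<close> asks for nonpositive values on lower faces.\<close>

theorem continuum_of_symmetric_orbits:
  obtains \<delta> C where "0 < \<delta>" "\<delta> < a" "compact C" "connected C" "C \<subseteq> UNIV \<times> {-a<..<a}"
    "{-\<delta>..\<delta>} \<subseteq> snd ` C"
    "\<And>s \<mu>. (s, \<mu>) \<in> C \<Longrightarrow> \<exists>r. symmetric_orbit U g (\<rho>, 0) (0, s) \<mu> r"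
proof -
  have zero: "0 \<in> {-a<..<a}" using a by simp
  have \<rho>: "\<rho> > 0" using eta by simp
  let ?s = circular_speed
  define t1 t2 where "t1 = pi / 4 / angular_speed" and "t2 = 3 * pi / 4 / angular_speed"
  have t: "0 < t1" "t1 < t2" using speeds_pos by (simp_all add: t1_def t2_def divide_strict_right_mono)
  have phase1: "angular_speed * u \<le> pi / 4" if "u \<le> t1" for u
    using that speeds_pos by (simp add: t1_def field_simps)
  have phase2: "pi / 4 \<le> angular_speed * u" "angular_speed * u \<le> 3 * pi / 4" if "u \<in> {t1..t2}" for u
    using that speeds_pos by (simp_all add: t1_def t2_def field_simps)
  \<comment> \<open>The open conditions that the circular orbit satisfies: the first up to time \<open>t2\<close>, the second
up to \<open>t1\<close>, the third between \<open>t1\<close> and \<open>t2\<close>, the last at \<open>t2\<close>.\<close>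
  define W1 where "W1 = {z :: plane \<times> plane. \<bar>norm (fst z) - \<rho>\<bar> < \<eta> \<and> 0 < momentum z}"
  define W2 where "W2 = {z. 0 < xc z}"
  define W3 where "W3 = {z. pc z < 0}"
  define W4 where "W4 = {z. xc z < 0}"
  have W: "open W1" "open W2" "open W3" "open W4"
    unfolding W1_def W2_def W3_def W4_def
    by (intro open_Collect_conj open_Collect_less continuous_intros)+
  have "flow ?s 0 u \<in> W1" for u
  proof -
    have trig: "(cos x)\<^sup>2 = 1 - (sin x)\<^sup>2" for x :: real by (rule cos_squared_eq)
    have "norm (fst (flow ?s 0 u)) = \<rho>"
      using \<rho> by (simp add: flow_circular norm_polar)
    moreover have "momentum (flow ?s 0 u) = \<rho> * ?s"
      by (simp add: momentum_def flow_circular components_def trig algebra_simps power2_eq_square [symmetric])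
    ultimately show ?thesis using eta \<rho> speeds_pos by (simp add: W1_def)
  qed
  then obtain d1 where d1: "d1 > 0" "\<And>s \<mu> u. \<bar>s - ?s\<bar> < d1 \<Longrightarrow> \<bar>\<mu> - 0\<bar> < d1 \<Longrightarrow> u \<in> {0..t2} \<Longrightarrow> flow s \<mu> u \<in> W1"
    using flow_stays_in_open [OF zero order_refl W(1), of t2 ?s] by metis
  have "flow ?s 0 u \<in> W2" if "u \<in> {0..t1}" for u
  proof -
    have "0 \<le> angular_speed * u" using that speeds_pos by simp
    moreover have "angular_speed * u \<le> pi / 4" using that phase1 by simp
    ultimately have "- (pi / 2) < angular_speed * u" "angular_speed * u < pi / 2"
      using pi_gt_zero by linarith+
    then have "0 < cos (angular_speed * u)" by (rule cos_gt_zero_pi)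
    then show ?thesis using \<rho> by (simp add: W2_def flow_circular components_def)
  qed
  then obtain d2 where d2: "d2 > 0" "\<And>s \<mu> u. \<bar>s - ?s\<bar> < d2 \<Longrightarrow> \<bar>\<mu> - 0\<bar> < d2 \<Longrightarrow> u \<in> {0..t1} \<Longrightarrow> flow s \<mu> u \<in> W2"
    using flow_stays_in_open [OF zero order_refl W(2), of t1 ?s] by metis
  have "flow ?s 0 u \<in> W3" if "u \<in> {t1..t2}" for u
  proof -
    have "0 < angular_speed * u" "angular_speed * u < pi"
      using phase2 [OF that] pi_gt_zero by linarith+
    then have "0 < sin (angular_speed * u)" by (rule sin_gt_zero)
    then show ?thesis using speeds_pos by (simp add: W3_def flow_circular components_def)
  qed
  then obtain d3 where d3: "d3 > 0" "\<And>s \<mu> u. \<bar>s - ?s\<bar> < d3 \<Longrightarrow> \<bar>\<mu> - 0\<bar> < d3 \<Longrightarrow> u \<in> {t1..t2} \<Longrightarrow> flow s \<mu> u \<in> W3"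
    using flow_stays_in_open [OF zero less_imp_le [OF t(1)] W(3), of t2 ?s] by metis
  have "flow ?s 0 u \<in> W4" if "u \<in> {t2..t2}" for u
  proof -
    have "angular_speed * u = pi - pi / 4" using that speeds_pos by (simp add: t2_def)
    then have "cos (angular_speed * u) < 0" by (simp only: cos_pi_minus cos_45) simp
    then show ?thesis using \<rho> by (simp add: W4_def flow_circular components_def mult_pos_neg)
  qed
  then obtain d4 where d4: "d4 > 0" "\<And>s \<mu> u. \<bar>s - ?s\<bar> < d4 \<Longrightarrow> \<bar>\<mu> - 0\<bar> < d4 \<Longrightarrow> u \<in> {t2..t2} \<Longrightarrow> flow s \<mu> u \<in> W4"
    using flow_stays_in_open [OF zero less_imp_le [OF less_trans [OF t]] W(4), of t2 ?s] by metis
  define d where "d = min (min d1 d2) (min (min d3 d4) ?s) / 2"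
  have d: "0 < d" "d < d1" "d < d2" "d < d3" "d < d4" "d < ?s"
    using d1(1) d2(1) d3(1) d4(1) speeds_pos by (simp_all add: d_def)
  \<comment> \<open>Speeds below and above the circular one; \<open>\<rho> s\<^sup>2 - \<kappa>\<close> changes sign between them.\<close>
  define s1 s2 where "s1 = ?s - d" and "s2 = ?s + d"
  have runge_at: "runge (flow s 0 u) = norm (fst (flow s 0 u)) * (\<rho> * s\<^sup>2 - \<kappa>)"
    "0 < norm (fst (flow s 0 u))"
    if "\<bar>s - ?s\<bar> \<le> d" "u \<in> {t1..t2}" for s u
  proof -
    have in_W1: "flow s 0 v \<in> W1" if "v \<in> {0..t2}" for v
      using d1(2) [of s 0 v] that \<open>\<bar>s - ?s\<bar> \<le> d\<close> d by simp
    then show "runge (flow s 0 u) = norm (fst (flow s 0 u)) * (\<rho> * s\<^sup>2 - \<kappa>)"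
      using that t by (intro runge_conserved) (auto simp: W1_def less_imp_le)
    show "0 < norm (fst (flow s 0 u))" using in_W1 [of u] that t eta by (auto simp: W1_def)
  qed
  have runge_cont: "continuous_on S (\<lambda>z. runge (h z))" if "continuous_on S h" for S and h :: "'c::topological_space \<Rightarrow> plane \<times> plane"
    unfolding runge_def using that by (intro continuous_intros)
  have "flow s1 0 u \<in> {z. runge z < 0}" if "u \<in> {t1..t2}" for u
  proof -
    have "s1\<^sup>2 < ?s\<^sup>2" using d by (intro power_strict_mono) (auto simp: s1_def)
    then have "\<rho> * s1\<^sup>2 < \<kappa>" using circular_speed_squared \<rho> by (metis mult_strict_left_mono)
    then show ?thesis using runge_at [of s1 u] that d by (simp add: s1_def mult_pos_neg)
  qed
  moreover have "open {z. runge z < 0}" "open {z. 0 < runge z}"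
    by (intro open_Collect_less runge_cont continuous_intros)+
  ultimately obtain d5 where d5: "d5 > 0" "\<And>\<mu> u. \<bar>\<mu>\<bar> < d5 \<Longrightarrow> u \<in> {t1..t2} \<Longrightarrow> runge (flow s1 \<mu> u) < 0"
    using flow_stays_in_open [OF zero less_imp_le [OF t(1)], of "{z. runge z < 0}" t2 s1]
    by (metis abs_zero diff_self diff_zero mem_Collect_eq)
  have "flow s2 0 u \<in> {z. 0 < runge z}" if "u \<in> {t1..t2}" for u
  proof -
    have "?s\<^sup>2 < s2\<^sup>2" using d speeds_pos by (intro power_strict_mono) (auto simp: s2_def)
    then have "\<kappa> < \<rho> * s2\<^sup>2" using circular_speed_squared \<rho> by (metis mult_strict_left_mono)
    then show ?thesis using runge_at [of s2 u] that d by (simp add: s2_def)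
  qed
  then obtain d6 where d6: "d6 > 0" "\<And>\<mu> u. \<bar>\<mu>\<bar> < d6 \<Longrightarrow> u \<in> {t1..t2} \<Longrightarrow> 0 < runge (flow s2 \<mu> u)"
    using flow_stays_in_open [OF zero less_imp_le [OF t(1)] \<open>open {z. 0 < runge z}\<close>, of t2 s2]
    by (metis abs_zero diff_self diff_zero mem_Collect_eq)
  define \<delta> where "\<delta> = min (min d a) (min d5 d6) / 2"
  have \<delta>: "0 < \<delta>" "\<delta> < a" "\<delta> < d" "\<delta> < d5" "\<delta> < d6"
    using d(1) d5(1) d6(1) a by (simp_all add: \<delta>_def)
  define F where "F = (\<lambda>((u, s), \<mu>). (- xc (flow s \<mu> u), runge (flow s \<mu> u)))"
  have s12: "s1 < s2" using d by (simp add: s1_def s2_def)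
  have box: "cbox (t1, s1) (t2, s2) = {t1..t2} \<times> {s1..s2}" by (simp add: cbox_Pair_eq)
  have near: "\<bar>s - ?s\<bar> \<le> d" if "s \<in> {s1..s2}" for s using that by (auto simp: s1_def s2_def)
  obtain Z where Z: "compact Z" "connected Z" "Z \<subseteq> cbox (t1, s1) (t2, s2) \<times> {-\<delta>..\<delta>}"
    "\<forall>z\<in>Z. F z = 0" "{-\<delta>..\<delta>} \<subseteq> snd ` Z"
  proof (rule continuum_of_zeros)
    show "cbox (t1, s1) (t2, s2) \<noteq> {}" using t s12 by (simp add: box)
    show "-\<delta> < \<delta>" using \<delta> by simp
    have "continuous_on (({0..t2} \<times> UNIV) \<times> {-a<..<a}) (\<lambda>z. flow (snd (fst z)) (snd z) (fst (fst z)))"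
      using continuous_flow [of t2] t by (simp add: case_prod_unfold)
    moreover have "cbox (t1, s1) (t2, s2) \<times> {-\<delta>..\<delta>} \<subseteq> ({0..t2} \<times> UNIV) \<times> {-a<..<a}"
      using t \<delta> by (auto simp: box)
    ultimately have "continuous_on (cbox (t1, s1) (t2, s2) \<times> {-\<delta>..\<delta>}) (\<lambda>z. flow (snd (fst z)) (snd z) (fst (fst z)))"
      by (rule continuous_on_subset)
    then show "continuous_on (cbox (t1, s1) (t2, s2) \<times> {-\<delta>..\<delta>}) F"
      unfolding F_def case_prod_unfold by (intro continuous_intros runge_cont)
  next
    fix z :: "real \<times> real" and \<mu> :: real and i :: "real \<times> real"
    assume z: "z \<in> cbox (t1, s1) (t2, s2)" and \<mu>: "\<mu> \<in> {-\<delta>..\<delta>}" and i: "i \<in> Basis"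
    obtain u s where zs: "z = (u, s)" "u \<in> {t1..t2}" "s \<in> {s1..s2}" using z by (auto simp: box)
    have small: "\<bar>s - ?s\<bar> < d2" "\<bar>s - ?s\<bar> < d4" "\<bar>\<mu> - 0\<bar> < d2" "\<bar>\<mu> - 0\<bar> < d4" "\<bar>\<mu>\<bar> < d5" "\<bar>\<mu>\<bar> < d6"
      using near [OF zs(3)] \<mu> \<delta> d by auto
    have "i = (1, 0) \<or> i = (0, 1)" using i by (auto simp: Basis_prod_def)
    then show "F (z, \<mu>) \<bullet> i \<le> 0" if "z \<bullet> i = (t1, s1) \<bullet> i"
    proof
      assume i: "i = (1, 0)"
      then have "flow s \<mu> u \<in> W2" using d2(2) [of s \<mu> u] small that t zs by simp
      then show ?thesis using i zs by (simp add: F_def W2_def)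
    next
      assume i: "i = (0, 1)"
      then show ?thesis using d5(2) [of \<mu> u] small that zs by (simp add: F_def less_imp_le)
    qed
    show "F (z, \<mu>) \<bullet> i \<ge> 0" if "z \<bullet> i = (t2, s2) \<bullet> i"
      using \<open>i = (1, 0) \<or> i = (0, 1)\<close>
    proof
      assume i: "i = (1, 0)"
      then have "flow s \<mu> u \<in> W4" using d4(2) [of s \<mu> u] small that zs by simp
      then show ?thesis using i zs by (simp add: F_def W4_def)
    next
      assume i: "i = (0, 1)"
      then show ?thesis using d6(2) [of \<mu> u] small that zs by (simp add: F_def less_imp_le)
    qed
  qed
  define C where "C = (\<lambda>z. (snd (fst z), snd z)) ` Z"
  show thesis
  proof (rule that [OF \<delta>(1,2)])
    show "compact C" "connected C"
      unfolding C_def using Z(1,2)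
      by (auto intro!: compact_continuous_image connected_continuous_image continuous_intros)
    show "C \<subseteq> UNIV \<times> {-a<..<a}" using Z(3) \<delta> by (fastforce simp: C_def)
    show "{-\<delta>..\<delta>} \<subseteq> snd ` C" using Z(5) by (simp add: C_def image_image)
    fix s \<mu> assume "(s, \<mu>) \<in> C"
    then obtain T where TZ: "((T, s), \<mu>) \<in> Z" by (auto simp: C_def)
    then have T: "T \<in> {t1..t2}" and s: "s \<in> {s1..s2}" and \<mu>\<delta>: "\<mu> \<in> {-\<delta>..\<delta>}" using Z(3) by (auto simp: box)
    have \<mu>: "\<mu> \<in> {-a<..<a}" using \<mu>\<delta> \<delta> by auto
    have small: "\<bar>s - ?s\<bar> < d1" "\<bar>s - ?s\<bar> < d2" "\<bar>s - ?s\<bar> < d3" "\<bar>\<mu> - 0\<bar> < d1" "\<bar>\<mu> - 0\<bar> < d2" "\<bar>\<mu> - 0\<bar> < d3"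
      using near [OF s] \<mu>\<delta> \<delta> d by auto
    have W1: "flow s \<mu> u \<in> W1" if "u \<in> {0..T}" for u using d1(2) small that T by auto
    have xT: "xc (flow s \<mu> T) = 0" and runge0: "runge (flow s \<mu> T) = 0"
      using bspec [OF Z(4) TZ] by (auto simp: F_def zero_prod_def)
    have "T \<in> {0..T}" using T t by simp
    then have "0 < momentum (flow s \<mu> T)" "0 < norm (fst (flow s \<mu> T))"
      using W1 [of T] eta by (auto simp: W1_def)
    then have qT: "qc (flow s \<mu> T) = 0" using runge0 xT by (simp add: runge_def)
    \<comment> \<open>Up to \<open>t1\<close> the orbit is in the right half-plane; afterwards the abscissa decreases until \<open>T\<close>.\<close>
    have right: "0 < xc (flow s \<mu> u)" if "u \<in> {0..<T}" for u
    proof (cases "u \<le> t1")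
      case True
      then show ?thesis using d2(2) [of s \<mu> u] small that by (simp add: W2_def)
    next
      case False
      have "xc (flow s \<mu> T) < xc (flow s \<mu> u)"
      proof (rule DERIV_neg_imp_decreasing [where f = "\<lambda>u. xc (flow s \<mu> u)" and a = u and b = T])
        show "u < T" using that by simp
        fix v assume v: "u \<le> v" "v \<le> T"
        then have "flow s \<mu> v \<in> W3" using d3(2) [of s \<mu> v] small False T by simp
        then show "\<exists>y. ((\<lambda>u. xc (flow s \<mu> u)) has_real_derivative y) (at v) \<and> y < 0"
          using flow_components(1) [OF \<mu>, of s v] by (auto simp: W3_def)
      qed
      then show ?thesis using xT by simp
    qed
    have "symmetric_orbit U g (\<rho>, 0) (0, s) \<mu> (\<lambda>t. fst (flow s \<mu> t))"
      by (rule quarter_orbit_symmetric [OF \<mu> _ _ _ right xT qT])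
         (use T t W1 in \<open>auto simp: W1_def less_imp_le\<close>)
    then show "\<exists>r. symmetric_orbit U g (\<rho>, 0) (0, s) \<mu> r" by blast
  qed
qed

end

lemma annulus_in_open:
  assumes "open U" "sphere (0 :: plane) \<rho> \<subseteq> U" "0 < \<rho>"
  obtains \<eta> where "0 < \<eta>" "2 * \<eta> < \<rho>" "{r. \<bar>norm r - \<rho>\<bar> \<le> 2 * \<eta>} \<subseteq> U"
proof -
  obtain e where e: "e > 0" "(\<Union>x\<in>sphere (0 :: plane) \<rho>. ball x e) \<subseteq> U"
    using compact_subset_open_imp_ball_epsilon_subset [OF compact_sphere assms(1,2)] .
  show thesis
  proof (rule that [of "min e \<rho> / 4"])
    show "0 < min e \<rho> / 4" "2 * (min e \<rho> / 4) < \<rho>" using e assms by auto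
    show "{r. \<bar>norm r - \<rho>\<bar> \<le> 2 * (min e \<rho> / 4)} \<subseteq> U"
    proof
      fix r :: plane assume "r \<in> {r. \<bar>norm r - \<rho>\<bar> \<le> 2 * (min e \<rho> / 4)}"
      then have r: "\<bar>norm r - \<rho>\<bar> < e" "norm r > 0" using e assms by auto
      have "dist ((\<rho> / norm r) *\<^sub>R r) r = norm ((\<rho> / norm r - 1) *\<^sub>R r)"
        by (simp add: dist_norm scaleR_diff_left)
      also have "\<dots> = \<bar>(\<rho> / norm r - 1) * norm r\<bar>" by (simp add: abs_mult)
      also have "(\<rho> / norm r - 1) * norm r = \<rho> - norm r" using r by (simp add: field_simps)
      finally have "r \<in> ball ((\<rho> / norm r) *\<^sub>R r) e" using r by (simp add: abs_minus_commute)
      moreover have "(\<rho> / norm r) *\<^sub>R r \<in> sphere 0 \<rho>" using r assms by simp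
      ultimately show "r \<in> U" using e(2) by blast
    qed
  qed
qed

theorem mainTheorem3:
  fixes \<rho> a \<kappa> :: real
    and x0 :: plane
    and U :: "plane set"
    and g :: "plane \<Rightarrow> real \<Rightarrow> plane"
  assumes "\<rho> > 0"
    and "x0 \<in> sphere 0 \<rho>" and "snd x0 = 0"
    and "open U" and "sphere 0 \<rho> \<subseteq> U" and "U \<subseteq> - {0}"
    and "a > 0"
    and "continuous_on (U \<times> {-a<..<a}) (\<lambda>(r, \<mu>). g r \<mu>)"
    and "\<kappa> > 0"
    and "\<And>r. r \<in> U \<Longrightarrow> g r 0 = - (\<kappa> / norm r ^ 3) *\<^sub>R r"
    and "\<And>\<mu>. \<mu> \<in> {-a<..<a} \<Longrightarrow> C1_on U (\<lambda>r. g r \<mu>)"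
    and "reflect1 ` U = U" and "reflect2 ` U = U"
    and "\<And>r \<mu>. r \<in> U \<Longrightarrow> \<mu> \<in> {-a<..<a} \<Longrightarrow> g (reflect1 r) \<mu> = reflect1 (g r \<mu>)"
    and "\<And>r \<mu>. r \<in> U \<Longrightarrow> \<mu> \<in> {-a<..<a} \<Longrightarrow> g (reflect2 r) \<mu> = reflect2 (g r \<mu>)"
  shows "\<exists>\<delta>0. 0 < \<delta>0 \<and> \<delta>0 < a \<and>
           (\<forall>\<mu>\<in>{-\<delta>0<..<\<delta>0}. \<exists>v. periodic_sol U g x0 v \<mu>) \<and>
           (\<exists>V :: (plane \<times> real) set.
              compact V \<and> connected V \<and> V \<subseteq> UNIV \<times> {-a<..<a} \<and>
              (\<forall>\<mu>\<in>{0..\<delta>0}. V \<inter> (UNIV \<times> {\<mu>}) \<noteq> {}) \<and>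
              (\<forall>(v, \<mu>)\<in>V.
                 periodic_sol U g x0 v \<mu> \<and>
                 simple_closed_curve (sol_trace U g x0 v \<mu>) \<and>
                 reflect1 ` sol_trace U g x0 v \<mu> = sol_trace U g x0 v \<mu> \<and>
                 reflect2 ` sol_trace U g x0 v \<mu> = sol_trace U g x0 v \<mu> \<and>
                 0 \<in> inside (sol_trace U g x0 v \<mu>)))"
proof -
  obtain \<eta> where \<eta>: "0 < \<eta>" "2 * \<eta> < \<rho>" "{r. \<bar>norm r - \<rho>\<bar> \<le> 2 * \<eta>} \<subseteq> U"
    using annulus_in_open [OF assms(4,5,1)] .
  interpret perturbed_kepler \<rho> \<eta> a \<kappa> U g
    by unfold_locales (use \<eta> assms in auto)
  obtain \<delta> C where \<delta>: "0 < \<delta>" "\<delta> < a" and C: "compact C" "connected C" "C \<subseteq> UNIV \<times> {-a<..<a}"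
    "{-\<delta>..\<delta>} \<subseteq> snd ` C"
    "\<And>s \<mu>. (s, \<mu>) \<in> C \<Longrightarrow> \<exists>r. symmetric_orbit U g (\<rho>, 0) (0, s) \<mu> r"
    using continuum_of_symmetric_orbits by metis
  obtain \<sigma> :: real where \<sigma>: "\<sigma> = 1 \<or> \<sigma> = -1" "x0 = (\<sigma> * \<rho>, 0)"
  proof -
    have "\<bar>fst x0\<bar> = \<rho>" using assms(2,3) by (cases x0) (simp add: norm_Pair)
    then have "fst x0 = 1 * \<rho> \<or> fst x0 = -1 * \<rho>" by auto
    then show thesis using that assms(3) by (metis prod.collapse)
  qed
  have orbit: "\<exists>r. symmetric_orbit U g x0 (0, \<sigma> * s) \<mu> r" if s: "(s, \<mu>) \<in> C" for s \<mu>
  proof -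
    have \<mu>: "\<mu> \<in> {-a<..<a}" using C(3) s by auto
    have odd: "- r \<in> U \<and> g (- r) \<mu> = - g r \<mu>" if "r \<in> U" for r
    proof -
      have neg: "- z = reflect1 (reflect2 z)" for z by (cases z) simp
      have "reflect2 r \<in> U" using that assms(13) by blast
      then show ?thesis
        unfolding neg using that \<mu> assms(12) assms(14,15) by (metis imageI)
    qed
    obtain r where r: "symmetric_orbit U g (\<rho>, 0) (0, s) \<mu> r" using C(5) [OF s] by blast
    from \<sigma>(1) show ?thesis
    proof
      assume "\<sigma> = 1"
      then show ?thesis using r \<sigma>(2) by auto
    next
      assume "\<sigma> = -1"
      then show ?thesis using symmetric_orbit_negate [OF r odd] \<sigma>(2) by auto
    qed
  qed
  define V where "V = (\<lambda>(s, \<mu>). ((0, \<sigma> * s) :: plane, \<mu>)) ` C"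
  have V_orbit: "periodic_sol U g x0 v \<mu> \<and> simple_closed_curve (sol_trace U g x0 v \<mu>) \<and>
      reflect1 ` sol_trace U g x0 v \<mu> = sol_trace U g x0 v \<mu> \<and>
      reflect2 ` sol_trace U g x0 v \<mu> = sol_trace U g x0 v \<mu> \<and> 0 \<in> inside (sol_trace U g x0 v \<mu>)"
    if "(v, \<mu>) \<in> V" for v \<mu>
  proof -
    obtain s where s: "(s, \<mu>) \<in> C" "v = (0, \<sigma> * s)" using \<open>(v, \<mu>) \<in> V\<close> by (auto simp: V_def)
    then have \<mu>: "\<mu> \<in> {-a<..<a}" using C(3) by auto
    obtain r where "symmetric_orbit U g x0 v \<mu> r" using orbit [OF s(1)] s(2) by blast
    with symmetric_orbit_sol [where g = g and \<mu> = \<mu>, OF C1 [OF \<mu>] openU] show ?thesis .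
  qed
  have V_slice: "\<exists>v. (v, \<mu>) \<in> V" if "\<mu> \<in> {-\<delta>..\<delta>}" for \<mu>
  proof -
    have "\<mu> \<in> snd ` C" using C(4) that by blast
    then obtain s where "(s, \<mu>) \<in> C" by auto
    then have "((0, \<sigma> * s), \<mu>) \<in> V" unfolding V_def by force
    then show ?thesis ..
  qed
  have "compact V" "connected V"
    unfolding V_def case_prod_unfold using C(1,2)
    by (auto intro!: compact_continuous_image connected_continuous_image continuous_intros)
  moreover have "V \<subseteq> UNIV \<times> {-a<..<a}" using C(3) by (auto simp: V_def)
  moreover have "\<forall>\<mu>\<in>{0..\<delta>}. V \<inter> (UNIV \<times> {\<mu>}) \<noteq> {}"
  proof
    fix \<mu> assume "\<mu> \<in> {0..\<delta>}"
    then obtain v where "(v, \<mu>) \<in> V" using V_slice [of \<mu>] \<delta> by auto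
    then show "V \<inter> (UNIV \<times> {\<mu>}) \<noteq> {}" by blast
  qed
  moreover have "\<forall>\<mu>\<in>{-\<delta><..<\<delta>}. \<exists>v. periodic_sol U g x0 v \<mu>"
  proof
    fix \<mu> assume "\<mu> \<in> {-\<delta><..<\<delta>}"
    then obtain v where "(v, \<mu>) \<in> V" using V_slice [of \<mu>] by auto
    then show "\<exists>v. periodic_sol U g x0 v \<mu>" using V_orbit by blast
  qed
  ultimately show ?thesis using \<delta>
    by (intro exI [of _ \<delta>] conjI exI [of _ V]) (assumption | (clarify, rule V_orbit, assumption))+
qed

end
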